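(* Let $\mu$ be a Carleson measure on $\mathbb{R}^2_+$. Then $$\mathrm{Carl}(\mu)\;\approx\;\sup_{E\subseteq\mathbb{R}^2_+,\ E\text{ Borel set}}\|S^d_{\mu_E}\|_{\mathrm{BMO}^d}\;\approx\;\sup_{I\subset\mathbb{R}\text{ interval}}\|S_{\mu_{Q_I}}\|_{\mathrm{BMO}}.$$ Here $\mu_E$ stands for the restriction of $\mu$ to $E$, given by $\mu_E(A)=\mu(E\cap A)$; $S^d$ denotes the dyadic balayage and $S$ the (Poisson) balayage; and $\approx$ denotes a two-sided estimate up to an absolute constant.
   Context: $\mathbb{R}^2_+ = \{(x,y)\in\mathbb{R}^2 : y>0\}$ is the upper half-plane. Measures on $\mathbb{R}^2_+$ are positive regular Borel measures. For an interval $I\subset\mathbb{R}$ of length $|I|$, the Carleson square over $I$ is $Q_I=\{(x,y): x\in I,\ 0<y\le |I|\}$. $\mathcal{D}$ denotes the set of left-half-open dyadic intervals in $\mathbb{R}$. For $I\in\mathcal{D}$, $T_I=\{(x,y): x\in I,\ |I|/2<y\le |I|\}$ is the top half of $Q_I$. A measure $\mu$ is a Carleson measure if there is a constant $C>0$ with $\mu(Q_I)\le C|I|$ for each interval $I\subset\mathbb{R}$ (it is sufficient to consider dyadic intervals). $\mathrm{Carl}(\mu)$ is the infimum of all $C>0$ such that $\mu(Q_I)\le C|I|$ for all $I\in\mathcal{D}$. The balayage of a measure $\mu$ is the function $S_\mu(t)=\int_{\mathbb{R}^2_+}p_{x,y}(t)\,d\mu(x,y)$, $t\in\mathbb{R}$,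 where $p_{x,y}(t)=\frac1\pi\frac{y}{y^2+(t-x)^2}$ is the Poisson kernel for $\mathbb{R}^2_+$. The dyadic balayage of $\mu$ is the $[0,\infty]$-valued function $S^d_\mu(t)=\sum_{I\in\mathcal{D}}\frac{\chi_I(t)}{|I|}\mu(T_I)$, $t\in\mathbb{R}$. Write $\langle b\rangle_I=\frac1{|I|}\int_I b(t)\,dt$. $\mathrm{BMO}(\mathbb{R})$ is the space of functions $b\in L^2(\mathbb{R})$ for which $\|b\|_{\mathrm{BMO}}=\sup_{I\subset\mathbb{R}\text{ interval}}\frac1{|I|}\int_I|b(t)-\langle b\rangle_I|\,dt$ is finite. Dyadic BMO, $\mathrm{BMO}^d(\mathbb{R})$, is the class of functions $b\in L^2(\mathbb{R})$ for which $\|b\|_{\mathrm{BMO}^d}^2=\sup_{I\in\mathcal{D}}\frac1{|I|}\int_I|b(t)-\langle b\rangle_I|^2\,dt$ is finite.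
   Formalization: The BMO^d norm is taken as the supremum of dyadic mean-square oscillations without requiring global L^2, with oscillation 0 on intervals where the function is a.e. infinite; for unbounded E the dyadic balayage of a Carleson measure can be infinite on a half-line, so its norm was undefined. *)

theory Defs
  imports "HOL-Analysis.Analysis"
begin

definition upper_half_plane :: "(real \<times> real) set" where
  "upper_half_plane = {(x, y). 0 < y}"

text \<open>Intervals are bounded and non-degenerate, since their length is divided by.\<close>

definition intervals :: "real set set" where
  "intervals = {I. is_interval I \<and> bounded I \<and> 0 < measure lborel I}"

abbreviation len :: "real set \<Rightarrow> real" where
  "len I \<equiv> measure lborel I"

definition dyadic_intervals :: "real set set" where
  "dyadic_intervals =
     {{of_int k * 2 powi n <.. (of_int k + 1) * 2 powi n} | k n :: int. True}"

definition carleson_square :: "real set \<Rightarrow> (real \<times> real) set" where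
  "carleson_square I = {(x, y). x \<in> I \<and> 0 < y \<and> y \<le> len I}"

definition top_half :: "real set \<Rightarrow> (real \<times> real) set" where
  "top_half I = {(x, y). x \<in> I \<and> len I / 2 < y \<and> y \<le> len I}"

definition regular_borel_measure :: "(real \<times> real) measure \<Rightarrow> bool" where
  "regular_borel_measure \<mu> \<longleftrightarrow>
     sets \<mu> = sets (restrict_space borel upper_half_plane) \<and>
     (\<forall>A\<in>sets \<mu>.
        emeasure \<mu> A = (INF U\<in>{U. open U \<and> A \<subseteq> U \<and> U \<subseteq> upper_half_plane}. emeasure \<mu> U) \<and>
        emeasure \<mu> A = (SUP K\<in>{K. compact K \<and> K \<subseteq> A}. emeasure \<mu> K))"

definition carleson_measure :: "(real \<times> real) measure \<Rightarrow> bool" where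
  "carleson_measure \<mu> \<longleftrightarrow> regular_borel_measure \<mu> \<and>
     (\<exists>C::real. C > 0 \<and>
        (\<forall>I\<in>intervals. emeasure \<mu> (carleson_square I) \<le> ennreal (C * len I)))"

definition Carl :: "(real \<times> real) measure \<Rightarrow> ennreal" where
  "Carl \<mu> = (INF C\<in>{C::real. C > 0 \<and>
     (\<forall>I\<in>dyadic_intervals. emeasure \<mu> (carleson_square I) \<le> ennreal (C * len I))}. ennreal C)"

text \<open>The restriction keeps the space and \<open>\<sigma>\<close>-algebra of \<open>\<mu>\<close>, unlike \<^const>\<open>restrict_space\<close>;
  see \<open>emeasure_measure_restriction\<close> below.\<close>

definition measure_restriction ::
    "(real \<times> real) measure \<Rightarrow> (real \<times> real) set \<Rightarrow> (real \<times> real) measure" where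
  "measure_restriction \<mu> E = density \<mu> (indicator E)"

lemma sets_measure_restriction: "sets (measure_restriction \<mu> E) = sets \<mu>"
  by (simp add: measure_restriction_def)

lemma emeasure_measure_restriction:
  assumes "E \<in> sets \<mu>" "A \<in> sets \<mu>"
  shows "emeasure (measure_restriction \<mu> E) A = emeasure \<mu> (E \<inter> A)"
  unfolding measure_restriction_def using assms
  by (subst emeasure_density) (auto simp flip: indicator_inter_arith)

lemma dyadic_intervals_subset: "dyadic_intervals \<subseteq> intervals"
  by (auto simp: dyadic_intervals_def intervals_def is_interval_oc algebra_simps)

lemma carleson_square_measurable:
  assumes "I \<in> intervals"
  shows "carleson_square I \<in> sets (restrict_space borel upper_half_plane)"
proof -
  have "carleson_square I = (I \<times> {0<..len I}) \<inter> upper_half_plane"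
    by (auto simp: carleson_square_def upper_half_plane_def)
  moreover have "I \<times> {0<..len I} \<in> sets borel"
    using assms by (intro borel_Times) (auto simp: intervals_def intro: real_interval_borel_measurable)
  ultimately show ?thesis by (auto simp: sets_restrict_space)
qed

lemma top_half_measurable:
  assumes "I \<in> intervals"
  shows "top_half I \<in> sets (restrict_space borel upper_half_plane)"
proof -
  have "top_half I = (I \<times> {len I / 2<..len I}) \<inter> upper_half_plane"
    using assms by (auto simp: top_half_def upper_half_plane_def intervals_def)
  moreover have "I \<times> {len I / 2<..len I} \<in> sets borel"
    using assms by (intro borel_Times) (auto simp: intervals_def intro: real_interval_borel_measurable)
  ultimately show ?thesis by (auto simp: sets_restrict_space)
qed

definition poisson_kernel :: "real \<Rightarrow> real \<Rightarrow> real \<Rightarrow> real" where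
  "poisson_kernel x y t = 1 / pi * (y / (y\<^sup>2 + (t - x)\<^sup>2))"

definition balayage :: "(real \<times> real) measure \<Rightarrow> real \<Rightarrow> ennreal" where
  "balayage \<mu> t = (\<integral>\<^sup>+(x, y). ennreal (poisson_kernel x y t) \<partial>\<mu>)"

definition dyadic_balayage :: "(real \<times> real) measure \<Rightarrow> real \<Rightarrow> ennreal" where
  "dyadic_balayage \<mu> t =
     (\<Sum>\<^sub>\<infinity>I\<in>dyadic_intervals. indicator I t / ennreal (len I) * emeasure \<mu> (top_half I))"

definition mean :: "(real \<Rightarrow> real) \<Rightarrow> real set \<Rightarrow> real" where
  "mean b I = (LINT t:I|lborel. b t) / len I"

definition mean_osc :: "nat \<Rightarrow> (real \<Rightarrow> real) \<Rightarrow> real set \<Rightarrow> ennreal" where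
  "mean_osc p b I =
     (if set_integrable lborel I b
      then (\<integral>\<^sup>+t\<in>I. ennreal (\<bar>b t - mean b I\<bar> ^ p) \<partial>lborel) / ennreal (len I)
      else \<infinity>)"

text \<open>The norm is \<open>\<infinity>\<close> exactly when the function is not in BMO; membership in BMO includes
  square integrability.\<close>

definition bmo_norm :: "(real \<Rightarrow> real) \<Rightarrow> ennreal" where
  "bmo_norm b =
     (if b \<in> borel_measurable lborel \<and> integrable lborel (\<lambda>t. (b t)\<^sup>2)
      then (SUP I\<in>intervals. mean_osc 1 b I) else \<infinity>)"

text \<open>A \<open>[0,\<infinity>]\<close>-valued function is regarded as a real function if it is finite almost
  everywhere, and is not in BMO otherwise.\<close>

definition bmo_norm_ext :: "(real \<Rightarrow> ennreal) \<Rightarrow> ennreal" where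
  "bmo_norm_ext f =
     (if AE t in lborel. f t < \<infinity> then bmo_norm (\<lambda>t. enn2real (f t)) else \<infinity>)"

definition ennreal_sqrt :: "ennreal \<Rightarrow> ennreal" where
  "ennreal_sqrt x = (if x = \<infinity> then \<infinity> else ennreal (sqrt (enn2real x)))"

text \<open>For a Carleson measure the dyadic balayage need not be in \<open>L\<^sup>2\<close>, and can be infinite on a
  half-line: take \<open>\<mu>(T\<^sub>I) = |I|\<close> for \<open>I = (0, 2\<^sup>k]\<close>, \<open>k \<ge> 0\<close>. What always makes sense is its
  oscillation on each dyadic interval, BMO being a space modulo constants: on \<open>I\<close> it is the constant
  contributed by the dyadic intervals strictly containing \<open>I\<close>, possibly \<open>\<infinity>\<close>, plus a function in
  \<open>L\<^sup>2(I)\<close>. Hence the norm is the supremum of the oscillations, without global square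
  integrability, and the constant function \<open>\<infinity>\<close> oscillates by \<open>0\<close>. Being infinite on
  part of \<open>I\<close> of positive measure only, or not being square integrable on \<open>I\<close>, gives norm
  \<open>\<infinity>\<close>. For finite-valued \<open>L\<^sup>2\<close> functions this is the usual norm.\<close>

definition dyadic_osc_ext :: "(real \<Rightarrow> ennreal) \<Rightarrow> real set \<Rightarrow> ennreal" where
  "dyadic_osc_ext f I =
     (if AE t\<in>I in lborel. f t = \<infinity> then 0
      else if AE t\<in>I in lborel. f t < \<infinity> then mean_osc 2 (\<lambda>t. enn2real (f t)) I
      else \<infinity>)"

definition dyadic_bmo_norm_ext :: "(real \<Rightarrow> ennreal) \<Rightarrow> ennreal" where
  "dyadic_bmo_norm_ext f = ennreal_sqrt (SUP I\<in>dyadic_intervals. dyadic_osc_ext f I)"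

definition comparable :: "real \<Rightarrow> ennreal \<Rightarrow> ennreal \<Rightarrow> bool" where
  "comparable C a b \<longleftrightarrow> a \<le> ennreal C * b \<and> b \<le> ennreal C * a"

end

theory Submission
  imports Defs
begin

text \<open>Dyadic side: on a dyadic \<open>I\<close> the dyadic balayage is a constant plus the sum \<open>g\<close> over \<open>J \<subseteq> I\<close>, and
  expanding the square and ordering nested pairs gives \<open>\<integral> g\<^sup>2 \<le> 2 C\<^sup>2 |I|\<close>. Conversely, for \<open>E = Q\<^sub>I\<close> the
  dyadic balayage vanishes on the sibling of \<open>I\<close> and has integral \<open>\<mu>(Q\<^sub>I)\<close> over \<open>I\<close>, so it oscillates on
  the parent of \<open>I\<close>. Poisson side: the kernel \<open>r / (r\<^sup>2 + (x - a)\<^sup>2 + y\<^sup>2)\<close> has integral \<open>O(C)\<close> against a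
  Carleson measure. It dominates the average over \<open>[a - r, a + r]\<close> of \<open>|p\<^sub>z(t) - p\<^sub>z(a)|\<close> for far \<open>z\<close> and of
  \<open>p\<^sub>z(t)\<close> for near \<open>z\<close>, which bounds the BMO norm, and it also controls \<open>\<integral> p\<^sub>z p\<^sub>w\<close>, which gives square
  integrability. Conversely, the balayage of \<open>\<mu>\<close> on \<open>Q\<^sub>I\<close> is large near \<open>I\<close> and small at distance \<open>7|I|\<close>.\<close>

section \<open>Integrals, series and the Carleson constant\<close>

text \<open>The two square estimates are one argument, \<open>nn_integral_kernel_power2_le\<close>:
  the overlap of two kernels is charged to the larger one, the smaller interval or the lower point
  being the variable integrated first, so that a Carleson bound at a single scale remains. On the
  dyadic side this bounds the norm itself. On the Poisson side it gives only membership in the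
  space, and the norm comes from a first-order comparison with a constant. The obstacle on the
  dyadic side is infinite mass: \<open>E\<close> is arbitrary, and the intervals above
  \<open>I\<close> may contribute an infinite constant, so the balayage is split on each
  \<open>I\<close> separately. On the Poisson side the restriction to a Carleson square has finite
  mass, and global integrability is available. Since \<open>Carl\<close> tests dyadic squares only,
  every centred box has to be covered by dyadic squares first. Both lower bounds compare two sets of
  equal length, one carrying much of the balayage and one carrying little. Poisson kernels have no
  compact support, so the sibling interval is replaced by a set far enough away, at distance 7|I|,
  for the tails to be small.\<close>

lemma infsum_ennreal_eq_nn_integral_count_space:
  fixes f :: "'a \<Rightarrow> ennreal"
  assumes "countable A"
  shows "infsum f A = (\<integral>\<^sup>+x. f x \<partial>count_space A)"
proof (cases "A = {}")
  case False
  have sum_eq: "(\<integral>\<^sup>+x. f x * indicator F x \<partial>count_space A) = sum f F"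
    if "finite F" "F \<subseteq> A" for F
    by (subst nn_integral_count_space'[of F])
      (use that in \<open>auto simp: indicator_def intro!: sum.cong\<close>)
  have SUP: "infsum f A = (SUP F\<in>{F. finite F \<and> F \<subseteq> A}. sum f F)"
    by (rule nonneg_infsum_complete) auto
  \<comment> \<open>Finite sets increasing to \<open>A\<close>, so that monotone convergence applies
    along a sequence.\<close>
  define g where "g n = from_nat_into A ` {..<n::nat}" for n
  have g: "finite (g n)" "g n \<subseteq> A" for n
    using False by (auto simp: g_def intro: from_nat_into)
  have pt: "f x = (SUP n. f x * indicator (g n) x)" if x: "x \<in> A" for x
  proof (rule antisym)
    obtain k where "x = from_nat_into A k"
      using from_nat_into_surj[OF assms x] by auto
    then have "x \<in> g (Suc k)" by (auto simp: g_def)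
    then show "f x \<le> (SUP n. f x * indicator (g n) x)"
      by (intro SUP_upper2[of "Suc k"]) auto
  qed (auto intro!: SUP_least simp: indicator_def)
  have "(\<integral>\<^sup>+x. f x \<partial>count_space A) = (\<integral>\<^sup>+x. (SUP n. f x * indicator (g n) x) \<partial>count_space A)"
    using pt by (intro nn_integral_cong) auto
  also have "\<dots> = (SUP n. \<integral>\<^sup>+x. f x * indicator (g n) x \<partial>count_space A)"
    by (rule nn_integral_monotone_convergence_SUP)
      (auto simp: incseq_def le_fun_def g_def indicator_def)
  also have "\<dots> = (SUP n. sum f (g n))"
    using g by (simp add: sum_eq)
  also have "\<dots> \<le> infsum f A"
    unfolding SUP using g by (intro SUP_least SUP_upper) auto
  finally have "(\<integral>\<^sup>+x. f x \<partial>count_space A) \<le> infsum f A" .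
  moreover have "infsum f A \<le> (\<integral>\<^sup>+x. f x \<partial>count_space A)"
    unfolding SUP
  proof (rule SUP_least, safe)
    fix F assume "finite F" "F \<subseteq> A"
    then have "sum f F = (\<integral>\<^sup>+x. f x * indicator F x \<partial>count_space A)"
      by (simp add: sum_eq)
    also have "\<dots> \<le> (\<integral>\<^sup>+x. f x \<partial>count_space A)"
      by (intro nn_integral_mono) (auto simp: indicator_def)
    finally show "sum f F \<le> (\<integral>\<^sup>+x. f x \<partial>count_space A)" .
  qed
  ultimately show ?thesis by (rule antisym[rotated])
qed (simp add: nn_integral_empty)

text \<open>The square is a double integral over \<open>M\<close>; Tonelli moves \<open>t\<close>
  innermost, and the two halves of the symmetrised bound have equal integrals, whence the factor 2.
  \<open>G\<close> is meant to be one-sided: in both applications \<open>G z w\<close> vanishes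
  unless \<open>w\<close> is the smaller object, and the Carleson condition at \<open>z\<close> then
  supplies \<open>A\<close>.\<close>

lemma nn_integral_kernel_power2_le:
  fixes k :: "'a \<Rightarrow> 'b \<Rightarrow> ennreal" and G :: "'a \<Rightarrow> 'a \<Rightarrow> ennreal"
  assumes M: "sigma_finite_measure M" and N: "sigma_finite_measure N"
    and k[measurable]: "case_prod k \<in> borel_measurable (M \<Otimes>\<^sub>M N)"
    and G[measurable]: "case_prod G \<in> borel_measurable (M \<Otimes>\<^sub>M M)"
    and kG: "\<And>z w. z \<in> space M \<Longrightarrow> w \<in> space M \<Longrightarrow> (\<integral>\<^sup>+t. k z t * k w t \<partial>N) \<le> G z w + G w z"
    and GA: "\<And>z. z \<in> space M \<Longrightarrow> (\<integral>\<^sup>+w. G z w \<partial>M) \<le> A"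
  shows "(\<integral>\<^sup>+t. (\<integral>\<^sup>+z. k z t \<partial>M)\<^sup>2 \<partial>N) \<le> 2 * A * emeasure M (space M)"
proof -
  interpret M: sigma_finite_measure M by fact
  interpret N: sigma_finite_measure N by fact
  interpret MN: pair_sigma_finite M N ..
  interpret MM: pair_sigma_finite M M ..
  have k'[measurable]: "(\<lambda>t. k z t) \<in> borel_measurable N" if "z \<in> space M" for z
    using measurable_compose_Pair1[OF that k] by simp
  have k''[measurable]: "(\<lambda>z. k z t) \<in> borel_measurable M" if "t \<in> space N" for t
    using measurable_compose[OF measurable_Pair2'[OF that] k] by simp
  have "(\<integral>\<^sup>+t. (\<integral>\<^sup>+z. k z t \<partial>M)\<^sup>2 \<partial>N) = (\<integral>\<^sup>+t. (\<integral>\<^sup>+z. (\<integral>\<^sup>+w. k z t * k w t \<partial>M) \<partial>M) \<partial>N)"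
    by (intro nn_integral_cong)
      (simp add: nn_integral_cmult nn_integral_multc power2_eq_square)
  also have "\<dots> = (\<integral>\<^sup>+z. (\<integral>\<^sup>+t. (\<integral>\<^sup>+w. k z t * k w t \<partial>M) \<partial>N) \<partial>M)"
    by (rule MN.Fubini') measurable
  also have "\<dots> = (\<integral>\<^sup>+z. (\<integral>\<^sup>+w. (\<integral>\<^sup>+t. k z t * k w t \<partial>N) \<partial>M) \<partial>M)"
    by (intro nn_integral_cong MN.Fubini') measurable
  also have "\<dots> \<le> (\<integral>\<^sup>+z. (\<integral>\<^sup>+w. G z w + G w z \<partial>M) \<partial>M)"
    by (intro nn_integral_mono kG)
  also have "\<dots> = (\<integral>\<^sup>+z. (\<integral>\<^sup>+w. G z w \<partial>M) + (\<integral>\<^sup>+w. G w z \<partial>M) \<partial>M)"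
    by (intro nn_integral_cong nn_integral_add) measurable
  also have "\<dots> = (\<integral>\<^sup>+z. (\<integral>\<^sup>+w. G z w \<partial>M) \<partial>M) + (\<integral>\<^sup>+z. (\<integral>\<^sup>+w. G w z \<partial>M) \<partial>M)"
    by (intro nn_integral_add) measurable
  also have "(\<integral>\<^sup>+z. (\<integral>\<^sup>+w. G w z \<partial>M) \<partial>M) = (\<integral>\<^sup>+z. (\<integral>\<^sup>+w. G z w \<partial>M) \<partial>M)"
    by (rule MM.Fubini') measurable
  also have "(\<integral>\<^sup>+z. (\<integral>\<^sup>+w. G z w \<partial>M) \<partial>M) \<le> (\<integral>\<^sup>+z. A \<partial>M)"
    by (intro nn_integral_mono GA)
  finally show ?thesis by (simp add: add_mono mult_2 distrib_right)
qed

text \<open>Upper bounds are proved for each competitor \<open>C\<close> in the infimum; linearity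
  in \<open>C\<close> is what lets them pass to \<open>Carl\<close>. Dividing by \<open>k\<close>
  first reduces this to the greatest lower bound property.\<close>

lemma le_mult_Carl:
  assumes "k > 0"
    and "\<And>C. C > 0 \<Longrightarrow> (\<And>I. I \<in> dyadic_intervals \<Longrightarrow>
            emeasure \<mu> (carleson_square I) \<le> ennreal (C * len I)) \<Longrightarrow> X \<le> ennreal (k * C)"
  shows "X \<le> ennreal k * Carl \<mu>"
proof -
  have "X / ennreal k \<le> Carl \<mu>"
    unfolding Carl_def
  proof (rule INF_greatest, safe)
    fix C :: real assume "C > 0"
      "\<forall>I\<in>dyadic_intervals. emeasure \<mu> (carleson_square I) \<le> ennreal (C * len I)"
    then have "X \<le> ennreal (k * C)" using assms(2) by blast
    then have "X / ennreal k \<le> ennreal (k * C) / ennreal k"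
      by (rule divide_right_mono_ennreal)
    then show "X / ennreal k \<le> ennreal C"
      using \<open>k > 0\<close> \<open>C > 0\<close> by (simp add: divide_ennreal)
  qed
  then have "ennreal k * (X / ennreal k) \<le> ennreal k * Carl \<mu>"
    by (rule mult_left_mono) simp
  then show ?thesis
    using \<open>k > 0\<close> by (simp add: ennreal_times_divide mult.commute[of _ X] ennreal_mult_divide_eq)
qed

lemma Carl_le:
  assumes "k > 0"
    and "\<And>I. I \<in> dyadic_intervals \<Longrightarrow>
            emeasure \<mu> (carleson_square I) \<le> ennreal k * X * ennreal (len I)"
  shows "Carl \<mu> \<le> ennreal k * X"
proof (cases "X = \<infinity>")
  case True
  then show ?thesis using \<open>k > 0\<close> by (simp add: ennreal_mult_top)
next
  case False
  then obtain x where x: "x \<ge> 0" "X = ennreal x" by (cases X) auto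
  \<comment> \<open>The infimum ranges over positive constants, and \<open>k * x\<close> may be 0,
    so it is approached from above.\<close>
  have "Carl \<mu> \<le> ennreal (k * x) + ennreal e" if "e > 0" for e
  proof -
    have "Carl \<mu> \<le> ennreal (k * x + e)"
      unfolding Carl_def
    proof (rule INF_lower, safe)
      show "0 < k * x + e" using x that \<open>k > 0\<close> by (simp add: add_nonneg_pos)
      fix I assume "I \<in> dyadic_intervals"
      then have "emeasure \<mu> (carleson_square I) \<le> ennreal (k * x * len I)"
        using assms(2)[of I] x \<open>k > 0\<close> by (simp add: ennreal_mult)
      also have "\<dots> \<le> ennreal ((k * x + e) * len I)"
        using that by (intro ennreal_leI mult_right_mono) auto
      finally show "emeasure \<mu> (carleson_square I) \<le> ennreal ((k * x + e) * len I)" .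
    qed
    then show ?thesis using x that \<open>k > 0\<close> by (simp add: ennreal_plus)
  qed
  then have "Carl \<mu> \<le> ennreal (k * x)"
    by (rule ennreal_le_epsilon)
  then show ?thesis using x \<open>k > 0\<close> by (simp add: ennreal_mult)
qed

section \<open>Dyadic intervals\<close>

lemma powi_2_less_iff: "(2::real) powi m < 2 powi n \<longleftrightarrow> m < n"
proof
  show "m < n" if "(2::real) powi m < 2 powi n"
    using that power_int_increasing[of n m "2::real"] by (cases "n \<le> m") auto
qed (simp add: power_int_strict_increasing)

lemma powi_2_le_iff: "(2::real) powi m \<le> 2 powi n \<longleftrightarrow> m \<le> n"
  using powi_2_less_iff[of n m] by (simp flip: not_less)

lemma dyadic_intervalE:
  assumes "I \<in> dyadic_intervals"
  obtains k n :: int where "I = {of_int k * 2 powi n <.. (of_int k + 1) * 2 powi n}"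
    and "len I = 2 powi n"
proof -
  obtain k n :: int where "I = {of_int k * 2 powi n <.. (of_int k + 1) * 2 powi n}"
    using assms by (auto simp: dyadic_intervals_def)
  moreover from this have "len I = 2 powi n"
    by (simp add: algebra_simps)
  ultimately show ?thesis by (rule that)
qed

lemma intervals_borel: "I \<in> intervals \<Longrightarrow> I \<in> sets borel"
  by (auto simp: intervals_def intro: real_interval_borel_measurable)

lemma dyadic_intervals_borel: "I \<in> dyadic_intervals \<Longrightarrow> I \<in> sets borel"
  using intervals_borel dyadic_intervals_subset by blast

lemma intervals_len_pos: "I \<in> intervals \<Longrightarrow> 0 < len I"
  by (simp add: intervals_def)

lemma dyadic_intervals_len_pos: "I \<in> dyadic_intervals \<Longrightarrow> 0 < len I"
  using intervals_len_pos dyadic_intervals_subset by blast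

lemma emeasure_interval_eq_len:
  assumes "I \<in> intervals"
  shows "emeasure lborel I = ennreal (len I)"
  using assms emeasure_bounded_finite[of I]
  by (intro emeasure_eq_ennreal_measure) (auto simp: intervals_def top.not_eq_extremum)

lemma countable_dyadic_intervals: "countable dyadic_intervals"
proof -
  have eq: "dyadic_intervals =
      (\<lambda>(k, n). {of_int k * 2 powi n <.. (of_int k + 1) * 2 powi n}) ` (UNIV :: (int \<times> int) set)"
    by (auto simp: dyadic_intervals_def)
  show ?thesis
    unfolding eq by (intro countable_image countableI_type)
qed

lemma dyadic_intervals_subset_if_len_le:
  assumes "I \<in> dyadic_intervals" "J \<in> dyadic_intervals" "x \<in> I" "x \<in> J" "len I \<le> len J"
  shows "I \<subseteq> J"
proof -
  obtain k n where I: "I = {of_int k * 2 powi n <.. (of_int k + 1) * 2 powi n}" "len I = 2 powi n"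
    using assms(1) by (rule dyadic_intervalE)
  obtain l m where J: "J = {of_int l * 2 powi m <.. (of_int l + 1) * 2 powi m}" "len J = 2 powi m"
    using assms(2) by (rule dyadic_intervalE)
  have "n \<le> m" using assms(5) unfolding I(2) J(2) by (simp add: powi_2_le_iff)
  \<comment> \<open>\<open>N\<close> is the ratio of the two lengths. In units of
    \<open>2 powi n\<close> all four endpoints are integers, so the strict inequalities through
    \<open>x\<close> sharpen to the two endpoint inequalities.\<close>
  define N :: int where "N = 2 ^ nat (m - n)"
  have N: "(2::real) powi m = of_int N * 2 powi n"
  proof -
    have "(2::real) powi m = 2 powi (m - n) * 2 powi n"
      by (simp flip: power_int_add)
    also have "(2::real) powi (m - n) = of_int N"
      using \<open>n \<le> m\<close> by (simp add: N_def power_int_def)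
    finally show ?thesis .
  qed
  have pos: "(0::real) < 2 powi n" by simp
  have xI: "of_int k * 2 powi n < x" "x \<le> (of_int k + 1) * 2 powi n"
    using assms(3) by (simp_all add: I(1))
  have xJ: "of_int l * of_int N * 2 powi n < x" "x \<le> (of_int l + 1) * of_int N * 2 powi n"
    using assms(4) by (simp_all add: J(1) N mult.assoc)
  have "of_int l * of_int N * 2 powi n < (of_int k + 1) * (2::real) powi n"
    using xJ(1) xI(2) by (rule less_le_trans)
  then have "of_int (l * N) < (of_int (k + 1) :: real)" using pos by simp
  then have 1: "l * N \<le> k" by linarith
  have "of_int k * 2 powi n < (of_int l + 1) * of_int N * (2::real) powi n"
    using xI(1) xJ(2) by (rule less_le_trans)
  then have "of_int k < (of_int ((l + 1) * N) :: real)" using pos by simp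
  then have 2: "k + 1 \<le> (l + 1) * N" by linarith
  have 1: "of_int l * of_int N * 2 powi n \<le> of_int k * (2::real) powi n"
    using 1 pos by (intro mult_right_mono) (simp_all flip: of_int_mult)
  have "(of_int (k + 1) :: real) \<le> of_int ((l + 1) * N)" using 2 of_int_le_iff by blast
  then have 2: "(of_int k + 1) * (2::real) powi n \<le> (of_int l + 1) * of_int N * 2 powi n"
    using pos by (intro mult_right_mono) simp_all
  show ?thesis
    unfolding I(1) J(1) N Ioc_subset_iff mult.assoc[symmetric]
    using 1 2 by blast
qed

lemma dyadic_cover:
  obtains k :: int where "x \<in> {of_int k * 2 powi n <.. (of_int k + 1) * (2::real) powi n}"
proof
  \<comment> \<open>The intervals are open on the left and closed on the right, hence the ceiling
    minus 1 and not the floor.\<close>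
  have "x \<le> of_int \<lceil>x / 2 powi n\<rceil> * 2 powi n"
    by (subst pos_divide_le_eq[symmetric]) simp_all
  moreover have "of_int \<lceil>x / 2 powi n\<rceil> - 1 < x / 2 powi n"
    by linarith
  ultimately show "x \<in> {of_int (\<lceil>x / 2 powi n\<rceil> - 1) * 2 powi n <.. (of_int (\<lceil>x / 2 powi n\<rceil> - 1) + 1) * (2::real) powi n}"
    by (simp add: field_simps)
qed

lemma ex_powi_2_bracket:
  assumes "(0::real) < y"
  shows "\<exists>n::int. 2 powi n / 2 < y \<and> y \<le> 2 powi n"
proof -
  define n where "n = \<lceil>log 2 y\<rceil>"
  have "log 2 y \<le> of_int n" "of_int n - 1 < log 2 y" unfolding n_def by linarith+
  then have "y \<le> 2 powr of_int n" "2 powr (of_int n - 1) < y"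
    using assms by (auto simp: log_le_iff less_log_iff)
  then have "2 powi n / 2 < y \<and> y \<le> 2 powi n"
    by (simp add: powr_real_of_int' powr_diff)
  then show ?thesis ..
qed

text \<open>The height of a point determines the length of its interval and the abscissa determines
  the position. This Whitney tiling expresses the mass of a Carleson square through the masses of
  top halves, the only data the dyadic balayage sees.\<close>

lemma carleson_square_eq_UN_top_half:
  assumes J: "J \<in> dyadic_intervals"
  shows "carleson_square J = (\<Union>K\<in>{K \<in> dyadic_intervals. K \<subseteq> J}. top_half K)"
proof (intro equalityI subsetI)
  fix z assume z: "z \<in> carleson_square J"
  obtain x y where xy: "z = (x, y)" "x \<in> J" "0 < y" "y \<le> len J"
    using z by (auto simp: carleson_square_def)
  obtain n :: int where n: "2 powi n / 2 < y" "y \<le> 2 powi n"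
    using ex_powi_2_bracket[OF xy(3)] by blast
  obtain k :: int where k: "x \<in> {of_int k * 2 powi n <.. (of_int k + 1) * 2 powi n}"
    by (rule dyadic_cover)
  define K where "K = {of_int k * 2 powi n <.. (of_int k + 1) * (2::real) powi n}"
  have K: "K \<in> dyadic_intervals" by (auto simp: K_def dyadic_intervals_def)
  have lenK: "len K = 2 powi n" by (simp add: K_def algebra_simps)
  obtain l m where "len J = 2 powi m" using J by (rule dyadic_intervalE)
  \<comment> \<open>Only \<open>n - 1 < m\<close> is visible from the heights; since exponents are
    integers this already gives \<open>n \<le> m\<close>.\<close>
  with n xy have "2 powi (n - 1) < (2::real) powi m"
    by (simp add: power_int_diff)
  then have "n - 1 < m" by (simp add: powi_2_less_iff)
  then have "len K \<le> len J"
    using \<open>len J = 2 powi m\<close> lenK by (simp add: powi_2_le_iff)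
  then have "K \<subseteq> J"
    using K J k xy(2) by (intro dyadic_intervals_subset_if_len_le[of K J x]) (auto simp: K_def)
  moreover have "z \<in> top_half K"
    using xy n k by (auto simp: top_half_def lenK) (auto simp: K_def)
  ultimately show "z \<in> (\<Union>K\<in>{K \<in> dyadic_intervals. K \<subseteq> J}. top_half K)" using K by blast
next
  fix z assume "z \<in> (\<Union>K\<in>{K \<in> dyadic_intervals. K \<subseteq> J}. top_half K)"
  then obtain K x y where K: "K \<in> dyadic_intervals" "K \<subseteq> J" "z = (x, y)" "x \<in> K"
    "len K / 2 < y" "y \<le> len K" by (auto simp: top_half_def)
  have "emeasure lborel K \<le> emeasure lborel J"
    using K J dyadic_intervals_borel by (intro emeasure_mono) auto
  then have "len K \<le> len J"
    using K(1) J dyadic_intervals_subset by (simp add: emeasure_interval_eq_len subset_iff)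
  then show "z \<in> carleson_square J"
    using K dyadic_intervals_len_pos[OF K(1)] by (auto simp: carleson_square_def)
qed

lemma top_half_inter_eq:
  assumes "I \<in> dyadic_intervals" "J \<in> dyadic_intervals" "z \<in> top_half I" "z \<in> top_half J"
  shows "I = J"
proof -
  have *: "len I \<le> len J" if "I \<in> dyadic_intervals" "J \<in> dyadic_intervals"
    "z \<in> top_half I" "z \<in> top_half J" for I J
  proof -
    obtain n where n: "len I = 2 powi n" by (rule dyadic_intervalE[OF \<open>I \<in> dyadic_intervals\<close>])
    obtain m where m: "len J = 2 powi m" by (rule dyadic_intervalE[OF \<open>J \<in> dyadic_intervals\<close>])
    have "len I / 2 < len J" using that by (auto simp: top_half_def)
    then have "2 powi (n - 1) < (2::real) powi m" by (simp add: power_int_diff n m)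
    then have "n - 1 < m" by (simp add: powi_2_less_iff)
    then show ?thesis by (simp add: n m powi_2_le_iff)
  qed
  obtain x where "x \<in> I" "x \<in> J" using assms by (auto simp: top_half_def)
  then show ?thesis
    using assms by (intro equalityI dyadic_intervals_subset_if_len_le[where x = x] *)
qed

text \<open>The condition \<open>K \<subseteq> J\<close> sits in the integrand so that the index set
  stays all of \<open>dyadic_intervals\<close>, in line with the sums it is compared with.\<close>

lemma nn_integral_top_half:
  assumes sets: "sets \<nu> = sets (restrict_space borel upper_half_plane)"
    and J: "J \<in> dyadic_intervals"
  shows "(\<integral>\<^sup>+K. (if K \<subseteq> J then emeasure \<nu> (top_half K) else 0) \<partial>count_space dyadic_intervals)
      = emeasure \<nu> (carleson_square J)"
proof -
  have "emeasure \<nu> (carleson_square J) =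
      (\<integral>\<^sup>+K. emeasure \<nu> (top_half K) \<partial>count_space {K \<in> dyadic_intervals. K \<subseteq> J})"
    unfolding carleson_square_eq_UN_top_half[OF J]
    using top_half_measurable dyadic_intervals_subset sets
    by (intro emeasure_UN_countable)
      (auto simp: disjoint_family_on_def countable_dyadic_intervals dest: top_half_inter_eq)
  also have "\<dots> = (\<integral>\<^sup>+K. (if K \<subseteq> J then emeasure \<nu> (top_half K) else 0) \<partial>count_space dyadic_intervals)"
    by (subst (1 2) nn_integral_count_space_indicator)
      (auto intro!: nn_integral_cong simp: indicator_def)
  finally show ?thesis ..
qed

section \<open>Dyadic balayage\<close>

text \<open>As an integral over a sigma-finite counting measure, the series becomes accessible to
  Tonelli together with \<open>lborel\<close>.\<close>

lemma dyadic_balayage_eq_nn_integral: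
  "dyadic_balayage \<nu> t =
     (\<integral>\<^sup>+K. indicator K t / ennreal (len K) * emeasure \<nu> (top_half K) \<partial>count_space dyadic_intervals)"
  unfolding dyadic_balayage_def
  by (rule infsum_ennreal_eq_nn_integral_count_space) (rule countable_dyadic_intervals)

lemma borel_measurable_count_space_dyadic:
  fixes g :: "real set \<Rightarrow> real \<Rightarrow> ennreal"
  assumes "\<And>K. K \<in> dyadic_intervals \<Longrightarrow> g K \<in> borel_measurable lborel"
  shows "(\<lambda>t. \<integral>\<^sup>+K. g K t \<partial>count_space dyadic_intervals) \<in> borel_measurable lborel"
proof -
  interpret sigma_finite_measure "count_space dyadic_intervals"
    by (rule sigma_finite_measure_count_space_countable) (rule countable_dyadic_intervals)
  have "(\<lambda>(t, K). g K t) \<in> borel_measurable (lborel \<Otimes>\<^sub>M count_space dyadic_intervals)"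
    using assms
    by (subst measurable_pair_swap_iff)
      (auto intro!: measurable_pair_measure_countable1 countable_dyadic_intervals simp: split_beta)
  then show ?thesis by (rule borel_measurable_nn_integral)
qed

lemma borel_measurable_dyadic_balayage: "dyadic_balayage \<nu> \<in> borel_measurable lborel"
proof -
  have "(\<lambda>t. indicator K t / ennreal (len K) * emeasure \<nu> (top_half K)) \<in> borel_measurable lborel"
    if "K \<in> dyadic_intervals" for K
    using dyadic_intervals_borel[OF that] by measurable
  from borel_measurable_count_space_dyadic[OF this] show ?thesis
    unfolding dyadic_balayage_eq_nn_integral[abs_def] .
qed

text \<open>A finite \<open>c\<close> cancels against the mean; an infinite \<open>c\<close> makes
  \<open>f\<close> infinite on all of \<open>I\<close>, where the oscillation is 0 by convention.
  For the mean \<open>m\<close> of \<open>g\<close>, the cross term in (g - m)^2 has a favourable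
  sign because \<open>g\<close> and \<open>m\<close> are nonnegative, so (g - m)^2 is at most g^2 +
  C^2 pointwise. Integration gives 2 C^2 + C^2 = 3 C^2.\<close>

lemma dyadic_osc_ext_le:
  assumes I: "I \<in> intervals" and "C \<ge> 0"
    and f[measurable]: "f \<in> borel_measurable lborel" and g[measurable]: "g \<in> borel_measurable lborel"
    and eq: "\<And>t. t \<in> I \<Longrightarrow> f t = c + g t"
    and g1: "(\<integral>\<^sup>+t\<in>I. g t \<partial>lborel) \<le> ennreal (C * len I)"
    and g2: "(\<integral>\<^sup>+t\<in>I. (g t)\<^sup>2 \<partial>lborel) \<le> ennreal (2 * C\<^sup>2 * len I)"
  shows "dyadic_osc_ext f I \<le> ennreal (3 * C\<^sup>2)"
proof (cases "c = \<infinity>")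
  case True
  then show ?thesis using eq by (simp add: dyadic_osc_ext_def)
next
  case False
  then obtain c' where c': "c' \<ge> 0" "c = ennreal c'" by (cases c) auto
  have [measurable]: "I \<in> sets borel" using I by (rule intervals_borel)
  have len: "len I > 0" using I by (rule intervals_len_pos)
  have eI: "emeasure lborel I = ennreal (len I)" using I by (rule emeasure_interval_eq_len)
  \<comment> \<open>A real-valued version cut off outside \<open>I\<close>, where nothing is known
    about \<open>g\<close>; it equals \<open>g\<close> almost everywhere on
    \<open>I\<close>.\<close>
  define g' where "g' t = enn2real (g t) * indicator I t" for t
  have [measurable]: "g' \<in> borel_measurable lborel" unfolding g'_def by measurable
  have g'0: "g' t \<ge> 0" for t by (simp add: g'_def)
  have "(\<integral>\<^sup>+t\<in>I. g t \<partial>lborel) \<noteq> \<infinity>" using g1 by (auto simp: top_unique)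
  then have "AE t in lborel. g t * indicator I t \<noteq> \<infinity>"
    by (intro nn_integral_PInf_AE) simp_all
  then have fin: "AE t in lborel. t \<in> I \<longrightarrow> g t < \<infinity>"
    by eventually_elim (auto simp: indicator_def top.not_eq_extremum)
  have g'_eq: "AE t in lborel. ennreal (g' t) = g t * indicator I t"
    using fin by eventually_elim (auto simp: g'_def indicator_def)
  have f_eq: "AE t in lborel. t \<in> I \<longrightarrow> enn2real (f t) = c' + g' t"
    using fin by eventually_elim (auto simp: g'_def eq c' enn2real_plus)
  have ffin: "AE t in lborel. t \<in> I \<longrightarrow> f t < \<infinity>"
    using fin by eventually_elim (auto simp: eq c')
  have g'1: "(\<integral>\<^sup>+t. ennreal (g' t) \<partial>lborel) \<le> ennreal (C * len I)"
    using g1 nn_integral_cong_AE[OF g'_eq] by simp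
  have g'2: "(\<integral>\<^sup>+t. ennreal ((g' t)\<^sup>2) \<partial>lborel) \<le> ennreal (2 * C\<^sup>2 * len I)"
  proof -
    have "(\<integral>\<^sup>+t. ennreal ((g' t)\<^sup>2) \<partial>lborel) = (\<integral>\<^sup>+t\<in>I. (g t)\<^sup>2 \<partial>lborel)"
    proof (rule nn_integral_cong_AE)
      show "AE t in lborel. ennreal ((g' t)\<^sup>2) = (g t)\<^sup>2 * indicator I t"
        using g'_eq
        by eventually_elim (auto simp: g'0 indicator_def simp flip: ennreal_power split: if_splits)
    qed
    with g2 show ?thesis by simp
  qed
  have int_g': "integrable lborel g'"
    using g'1 g'0 by (intro integrableI_nonneg) (auto simp: less_top[symmetric] top_unique)
  have int_ind: "integrable lborel (indicator I :: real \<Rightarrow> real)"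
    using eI by (intro integrable_real_indicator) auto
  have ind_eq: "AE t in lborel. indicat_real I t *\<^sub>R enn2real (f t) = c' * indicator I t + g' t"
    using f_eq by eventually_elim (auto simp: indicator_def g'_def)
  have set_int: "set_integrable lborel I (\<lambda>t. enn2real (f t))"
    unfolding set_integrable_def
    by (subst integrable_cong_AE[OF _ _ ind_eq]) (use int_g' int_ind in simp_all)
  define m where "m = (\<integral>t. g' t \<partial>lborel) / len I"
  have mean_eq: "mean (\<lambda>t. enn2real (f t)) I = c' + m"
  proof -
    have "(LINT t:I|lborel. enn2real (f t)) = (\<integral>t. c' * indicator I t + g' t \<partial>lborel)"
      unfolding set_lebesgue_integral_def
      by (rule integral_cong_AE[OF _ _ ind_eq]) simp_all
    also have "\<dots> = c' * len I + (\<integral>t. g' t \<partial>lborel)"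
      using int_g' int_ind by simp
    finally show ?thesis using len by (simp add: mean_def m_def field_simps)
  qed
  have m: "0 \<le> m" "m \<le> C"
  proof -
    have "ennreal (\<integral>t. g' t \<partial>lborel) \<le> ennreal (C * len I)"
      using g'1 nn_integral_eq_integral[OF int_g'] g'0 by simp
    then have "(\<integral>t. g' t \<partial>lborel) \<le> C * len I"
      using \<open>C \<ge> 0\<close> len by (simp add: ennreal_le_iff)
    then show "m \<le> C" using len by (simp add: m_def field_simps)
    show "0 \<le> m" unfolding m_def using g'0 len by simp
  qed
  have "(\<integral>\<^sup>+t\<in>I. ennreal (\<bar>enn2real (f t) - mean (\<lambda>t. enn2real (f t)) I\<bar>\<^sup>2) \<partial>lborel)
      \<le> (\<integral>\<^sup>+t. ennreal ((g' t)\<^sup>2) + ennreal (C\<^sup>2) * indicator I t \<partial>lborel)"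
  proof (rule nn_integral_mono_AE)
    show "AE t in lborel. ennreal (\<bar>enn2real (f t) - mean (\<lambda>t. enn2real (f t)) I\<bar>\<^sup>2) * indicator I t
        \<le> ennreal ((g' t)\<^sup>2) + ennreal (C\<^sup>2) * indicator I t"
      using f_eq
    proof eventually_elim
      fix t assume t: "t \<in> I \<longrightarrow> enn2real (f t) = c' + g' t"
      have "\<bar>g' t - m\<bar>\<^sup>2 \<le> (g' t)\<^sup>2 + C\<^sup>2"
      proof -
        have "\<bar>g' t - m\<bar>\<^sup>2 = (g' t)\<^sup>2 + m\<^sup>2 - 2 * (g' t * m)"
          by (simp add: power2_eq_square algebra_simps)
        also have "\<dots> \<le> (g' t)\<^sup>2 + C\<^sup>2"
          using mult_nonneg_nonneg[OF g'0[of t] m(1)] power_mono[OF m(2) m(1), of 2] by linarith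
        finally show ?thesis .
      qed
      then have "ennreal (\<bar>g' t - m\<bar>\<^sup>2) \<le> ennreal ((g' t)\<^sup>2) + ennreal (C\<^sup>2)"
        by (simp flip: ennreal_plus)
      then show "ennreal (\<bar>enn2real (f t) - mean (\<lambda>t. enn2real (f t)) I\<bar>\<^sup>2) * indicator I t
          \<le> ennreal ((g' t)\<^sup>2) + ennreal (C\<^sup>2) * indicator I t"
        using t by (cases "t \<in> I") (auto simp: mean_eq)
    qed
  qed
  also have "\<dots> = (\<integral>\<^sup>+t. ennreal ((g' t)\<^sup>2) \<partial>lborel) + ennreal (C\<^sup>2) * ennreal (len I)"
    by (subst nn_integral_add) (simp_all add: nn_integral_cmult_indicator eI)
  also have "\<dots> \<le> ennreal (2 * C\<^sup>2 * len I) + ennreal (C\<^sup>2) * ennreal (len I)"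
    using g'2 by (intro add_right_mono)
  also have "\<dots> = ennreal (3 * C\<^sup>2 * len I)"
    using len by (simp flip: ennreal_mult ennreal_plus add: algebra_simps)
  finally have "(\<integral>\<^sup>+t\<in>I. ennreal (\<bar>enn2real (f t) - mean (\<lambda>t. enn2real (f t)) I\<bar>\<^sup>2) \<partial>lborel) / ennreal (len I)
      \<le> ennreal (3 * C\<^sup>2 * len I) / ennreal (len I)"
    by (rule divide_right_mono_ennreal)
  also have "\<dots> = ennreal (3 * C\<^sup>2)" using len by (simp add: divide_ennreal)
  finally show ?thesis
    using ffin set_int by (simp add: dyadic_osc_ext_def mean_osc_def)
qed

text \<open>A dyadic interval through a point of \<open>I\<close> lies inside \<open>I\<close> or
  contains it. The containing ones contribute the same amount \<open>c\<close> at every point of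
  \<open>I\<close>. The inner ones, weighted by the masses of their top halves, form a measure
  \<open>M\<close> of total mass \<nu>(Q_I), and \<open>g\<close> is the integral of normalised
  indicators against \<open>M\<close>.\<close>

lemma dyadic_osc_ext_balayage_le:
  assumes sets: "sets \<nu> = sets (restrict_space borel upper_half_plane)"
    and "C > 0"
    and C: "\<And>I. I \<in> dyadic_intervals \<Longrightarrow> emeasure \<nu> (carleson_square I) \<le> ennreal (C * len I)"
    and I: "I \<in> dyadic_intervals"
  shows "dyadic_osc_ext (dyadic_balayage \<nu>) I \<le> ennreal (3 * C\<^sup>2)"
proof -
  define k :: "real set \<Rightarrow> real \<Rightarrow> ennreal" where "k K t = indicator K t / ennreal (len K)" for K t
  define a where "a K = (if K \<subseteq> I then emeasure \<nu> (top_half K) else 0)" for K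
  define M where "M = density (count_space dyadic_intervals) a"
  define g where "g t = (\<integral>\<^sup>+K. k K t \<partial>M)" for t
  \<comment> \<open>The order of the branches counts \<open>K = I\<close> in \<open>g\<close> and
    not in \<open>c\<close>. The value may be infinite.\<close>
  define c where "c = (\<integral>\<^sup>+K. (if K \<subseteq> I then 0 else if I \<subseteq> K
      then emeasure \<nu> (top_half K) / ennreal (len K) else 0) \<partial>count_space dyadic_intervals)"
  have M_eq: "(\<integral>\<^sup>+K. h K \<partial>M) = (\<integral>\<^sup>+K. a K * h K \<partial>count_space dyadic_intervals)" for h
    unfolding M_def by (rule nn_integral_density) simp_all
  have k_borel: "k K \<in> borel_measurable lborel" if "K \<in> dyadic_intervals" for K
    using dyadic_intervals_borel[OF that] unfolding k_def by measurable
  have int_k: "(\<integral>\<^sup>+t. k K t \<partial>lborel) = 1" if K: "K \<in> dyadic_intervals" for K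
    using dyadic_intervals_borel[OF K] dyadic_intervals_len_pos[OF K] K dyadic_intervals_subset
    unfolding k_def
    by (subst nn_integral_divide)
      (auto simp: emeasure_interval_eq_len subset_iff ennreal_divide_self)
  have k_le: "k K t \<le> 1 / ennreal (len K)" for K t
    unfolding k_def by (intro divide_right_mono_ennreal) (simp add: indicator_def)
  have space_M: "space M = dyadic_intervals" by (simp add: M_def)
  have sum_M: "(\<integral>\<^sup>+K. (if K \<subseteq> J then 1 else 0) \<partial>M) \<le> emeasure \<nu> (carleson_square J)"
    if J: "J \<in> dyadic_intervals" for J
    unfolding M_eq nn_integral_top_half[OF sets J, symmetric] a_def
    by (intro nn_integral_mono) auto
  have emeasure_M: "emeasure M (space M) \<le> ennreal (C * len I)"
  proof -
    have "emeasure M (space M) = (\<integral>\<^sup>+K. a K * 1 \<partial>count_space dyadic_intervals)"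
      using M_eq[of "\<lambda>_. 1"] by simp
    also have "\<dots> = emeasure \<nu> (carleson_square I)"
      using nn_integral_top_half[OF sets I] by (simp add: a_def)
    finally show ?thesis using C[OF I] by simp
  qed
  have finM: "finite_measure M"
    using emeasure_M by (intro finite_measureI) (auto simp: top_unique)
  then interpret M: finite_measure M .
  interpret P: pair_sigma_finite M lborel ..
  have sets_M: "sets M = sets (count_space dyadic_intervals)" by (simp add: M_def)
  have k_meas: "case_prod k \<in> borel_measurable (M \<Otimes>\<^sub>M lborel)"
    unfolding measurable_cong_sets[OF sets_pair_measure_cong[OF sets_M refl] refl]
    by (rule measurable_pair_measure_countable1[OF countable_dyadic_intervals])
      (simp only: prod.case k_borel)
  have g_borel: "g \<in> borel_measurable lborel"
    unfolding g_def M_eq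
    by (rule borel_measurable_count_space_dyadic)
      (intro borel_measurable_times_ennreal k_borel, auto)
  have int_g: "(\<integral>\<^sup>+t. g t \<partial>lborel) \<le> ennreal (C * len I)"
  proof -
    have "(\<integral>\<^sup>+t. g t \<partial>lborel) = (\<integral>\<^sup>+K. (\<integral>\<^sup>+t. k K t \<partial>lborel) \<partial>M)"
      unfolding g_def by (rule P.Fubini') (rule k_meas)
    also have "\<dots> = (\<integral>\<^sup>+K. 1 \<partial>M)"
      by (intro nn_integral_cong) (simp add: int_k space_M)
    finally show ?thesis using emeasure_M by simp
  qed
  have int_g2: "(\<integral>\<^sup>+t. (g t)\<^sup>2 \<partial>lborel) \<le> ennreal (2 * C\<^sup>2 * len I)"
  proof -
    \<comment> \<open>The larger interval is the first argument; its normalised indicator is at most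
      the inverse of its length.\<close>
    define G :: "real set \<Rightarrow> real set \<Rightarrow> ennreal"
      where "G J K = (if K \<subseteq> J then 1 / ennreal (len J) else 0)" for J K
    \<comment> \<open>Two dyadic intervals that share \<open>t\<close> are nested, so the kernel of
      the larger is replaced by its maximum and the kernel of the smaller, of integral 1, is
      kept.\<close>
    have kk: "k J t * k K t \<le> G J K * k K t + G K J * k J t"
      if "J \<in> dyadic_intervals" "K \<in> dyadic_intervals" for J K t
    proof (cases "t \<in> J \<and> t \<in> K")
      case True
      then have "J \<subseteq> K \<or> K \<subseteq> J"
        using dyadic_intervals_subset_if_len_le[OF that, of t]
          dyadic_intervals_subset_if_len_le[OF that(2,1), of t] by linarith
      then show ?thesis
      proof
        assume "K \<subseteq> J"
        then have "k J t * k K t \<le> G J K * k K t"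
          using k_le[of J t] by (auto simp: G_def intro: mult_right_mono)
        then show ?thesis by (rule order_trans) simp
      next
        assume "J \<subseteq> K"
        then have "k K t * k J t \<le> G K J * k J t"
          using k_le[of K t] by (auto simp: G_def intro: mult_right_mono)
        then show ?thesis by (subst mult.commute, elim order_trans) simp
      qed
    qed (auto simp: k_def)
    have "(\<integral>\<^sup>+t. (\<integral>\<^sup>+J. k J t \<partial>M)\<^sup>2 \<partial>lborel) \<le> 2 * ennreal C * emeasure M (space M)"
    proof (rule nn_integral_kernel_power2_le[where G = G])
      show "case_prod G \<in> borel_measurable (M \<Otimes>\<^sub>M M)"
        unfolding measurable_cong_sets[OF sets_pair_measure_cong[OF sets_M sets_M] refl]
        by (rule measurable_pair_measure_countable1[OF countable_dyadic_intervals]) simp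
    next
      fix J K assume "J \<in> space M" "K \<in> space M"
      then have JK: "J \<in> dyadic_intervals" "K \<in> dyadic_intervals" by (simp_all add: space_M)
      have "(\<integral>\<^sup>+t. k J t * k K t \<partial>lborel) \<le> (\<integral>\<^sup>+t. G J K * k K t + G K J * k J t \<partial>lborel)"
        using JK by (intro nn_integral_mono kk)
      also have "\<dots> = (\<integral>\<^sup>+t. G J K * k K t \<partial>lborel) + (\<integral>\<^sup>+t. G K J * k J t \<partial>lborel)"
        using JK k_borel
        by (intro nn_integral_add borel_measurable_times_ennreal k_borel) auto
      also have "\<dots> = G J K + G K J"
        using JK k_borel by (simp add: nn_integral_cmult int_k)
      finally show "(\<integral>\<^sup>+t. k J t * k K t \<partial>lborel) \<le> G J K + G K J" .
    next
      \<comment> \<open>Integrating \<open>G J\<close> sums the weights of the intervals inside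
        \<open>J\<close> and divides by |J|, so the bound is the Carleson condition at
        \<open>J\<close>.\<close>
      fix J assume "J \<in> space M"
      then have J: "J \<in> dyadic_intervals" by (simp add: space_M)
      note lenJ = dyadic_intervals_len_pos[OF J]
      have "(\<integral>\<^sup>+K. G J K \<partial>M) = (\<integral>\<^sup>+K. 1 / ennreal (len J) * (if K \<subseteq> J then 1 else 0) \<partial>M)"
        by (intro nn_integral_cong) (simp add: G_def)
      also have "\<dots> = 1 / ennreal (len J) * (\<integral>\<^sup>+K. (if K \<subseteq> J then 1 else 0) \<partial>M)"
        by (rule nn_integral_cmult) (simp add: M_def)
      also have "\<dots> \<le> 1 / ennreal (len J) * ennreal (C * len J)"
        using order_trans[OF sum_M[OF J] C[OF J]] by (rule mult_left_mono) simp
      also have "\<dots> = ennreal C"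
        using lenJ \<open>C > 0\<close>
        by (simp add: divide_ennreal_def ennreal_mult inverse_ennreal flip: ennreal_mult)
      finally show "(\<integral>\<^sup>+K. G J K \<partial>M) \<le> ennreal C" .
    qed (use k_meas M.sigma_finite_measure_axioms lborel.sigma_finite_measure_axioms in auto)
    also have "\<dots> \<le> 2 * ennreal C * ennreal (C * len I)"
      by (rule mult_left_mono[OF emeasure_M]) simp
    also have "\<dots> = ennreal (2 * C\<^sup>2 * len I)"
      using \<open>C > 0\<close>
      by (simp add: power2_eq_square mult.assoc flip: ennreal_mult ennreal_numeral)
    finally show ?thesis by (simp add: g_def)
  qed
  have decomp: "dyadic_balayage \<nu> t = c + g t" if t: "t \<in> I" for t
  proof -
    have "dyadic_balayage \<nu> t =
      (\<integral>\<^sup>+K. (if K \<subseteq> I then 0 else if I \<subseteq> K then emeasure \<nu> (top_half K) / ennreal (len K) else 0)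
          + a K * k K t \<partial>count_space dyadic_intervals)"
      unfolding dyadic_balayage_eq_nn_integral
    proof (rule nn_integral_cong)
      fix K assume "K \<in> space (count_space dyadic_intervals)"
      then have K: "K \<in> dyadic_intervals" by simp
      have "K \<subseteq> I \<or> I \<subseteq> K" if "t \<in> K"
        using dyadic_intervals_subset_if_len_le[OF I K t that]
          dyadic_intervals_subset_if_len_le[OF K I that t] by linarith
      then show "indicator K t / ennreal (len K) * emeasure \<nu> (top_half K) =
        (if K \<subseteq> I then 0 else if I \<subseteq> K then emeasure \<nu> (top_half K) / ennreal (len K) else 0)
          + a K * k K t"
        using t by (cases "t \<in> K")
          (auto simp: a_def k_def ennreal_times_divide mult.commute divide_ennreal_def)
    qed
    also have "\<dots> = c + g t"
      unfolding c_def g_def M_eq by (rule nn_integral_add) simp_all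
    finally show ?thesis .
  qed
  show ?thesis
  proof (rule dyadic_osc_ext_le)
    show "I \<in> intervals" using I dyadic_intervals_subset by blast
    show "(\<integral>\<^sup>+t\<in>I. g t \<partial>lborel) \<le> ennreal (C * len I)"
      by (rule order_trans[OF nn_integral_mono int_g]) (simp add: indicator_def)
    show "(\<integral>\<^sup>+t\<in>I. (g t)\<^sup>2 \<partial>lborel) \<le> ennreal (2 * C\<^sup>2 * len I)"
      by (rule order_trans[OF nn_integral_mono int_g2]) (simp add: indicator_def)
  qed (use \<open>C > 0\<close> g_borel borel_measurable_dyadic_balayage decomp in auto)
qed

lemma ennreal_sqrt_le_iff:
  assumes "d \<ge> 0"
  shows "ennreal_sqrt x \<le> ennreal d \<longleftrightarrow> x \<le> ennreal (d\<^sup>2)"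
proof (cases x)
  case (real r)
  then show ?thesis
    using assms by (auto simp: ennreal_sqrt_def ennreal_le_iff real_sqrt_le_iff' intro: real_le_lsqrt
      dest: sqrt_le_D)
qed (simp add: ennreal_sqrt_def top_unique)

lemma dyadic_bmo_norm_le_Carl:
  assumes \<mu>: "regular_borel_measure \<mu>" and E: "E \<in> sets borel" "E \<subseteq> upper_half_plane"
  shows "dyadic_bmo_norm_ext (dyadic_balayage (measure_restriction \<mu> E)) \<le> ennreal 2 * Carl \<mu>"
proof (rule le_mult_Carl)
  have sets: "sets \<mu> = sets (restrict_space borel upper_half_plane)"
    using \<mu> by (simp add: regular_borel_measure_def)
  then have E': "E \<in> sets \<mu>" using E by (auto simp: sets_restrict_space)
  fix C :: real assume "C > 0"
    and C: "\<And>I. I \<in> dyadic_intervals \<Longrightarrow> emeasure \<mu> (carleson_square I) \<le> ennreal (C * len I)"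
  have "dyadic_osc_ext (dyadic_balayage (measure_restriction \<mu> E)) I \<le> ennreal (3 * C\<^sup>2)"
    if "I \<in> dyadic_intervals" for I
  proof (rule dyadic_osc_ext_balayage_le[OF _ \<open>C > 0\<close> _ that])
    show "sets (measure_restriction \<mu> E) = sets (restrict_space borel upper_half_plane)"
      by (simp add: sets_measure_restriction sets)
    fix I assume I: "I \<in> dyadic_intervals"
    then have Q: "carleson_square I \<in> sets \<mu>"
      using carleson_square_measurable dyadic_intervals_subset sets by blast
    have "emeasure (measure_restriction \<mu> E) (carleson_square I) \<le> emeasure \<mu> (carleson_square I)"
      using E' Q by (simp add: emeasure_measure_restriction emeasure_mono)
    then show "emeasure (measure_restriction \<mu> E) (carleson_square I) \<le> ennreal (C * len I)"
      using C[OF I] by (rule order_trans)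
  qed
  then have "(SUP I\<in>dyadic_intervals. dyadic_osc_ext (dyadic_balayage (measure_restriction \<mu> E)) I)
      \<le> ennreal (3 * C\<^sup>2)" by (rule SUP_least)
  \<comment> \<open>The square root of 3 is rounded up to 2.\<close>
  also have "\<dots> \<le> ennreal ((2 * C)\<^sup>2)" by (intro ennreal_leI) (simp add: power_mult_distrib)
  finally show "dyadic_bmo_norm_ext (dyadic_balayage (measure_restriction \<mu> E)) \<le> ennreal (2 * C)"
    unfolding dyadic_bmo_norm_ext_def using \<open>C > 0\<close> by (subst ennreal_sqrt_le_iff) auto
qed simp

section \<open>Dyadic lower bound: testing on a single Carleson square\<close>

lemma dyadic_parent:
  assumes I: "I \<in> dyadic_intervals"
  obtains P where "P \<in> dyadic_intervals" "I \<subseteq> P" "len P = 2 * len I"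
proof -
  obtain k n :: int where kn: "I = {of_int k * 2 powi n <.. (of_int k + 1) * 2 powi n}" "len I = 2 powi n"
    using I by (rule dyadic_intervalE)
  \<comment> \<open>The right endpoint belongs to \<open>I\<close>; the dyadic interval of twice the
    length through it contains \<open>I\<close> by nestedness.\<close>
  define x :: real where "x = (of_int k + 1) * 2 powi n"
  have "x \<in> I" by (simp add: kn(1) x_def)
  obtain j :: int where j: "x \<in> {of_int j * 2 powi (n + 1) <.. (of_int j + 1) * 2 powi (n + 1)}"
    by (rule dyadic_cover)
  define P where "P = {of_int j * 2 powi (n + 1) <.. (of_int j + 1) * (2::real) powi (n + 1)}"
  have "len P = 2 powi (n + 1)" by (simp add: P_def algebra_simps)
  then have "len P = 2 * len I" by (simp add: kn(2) power_int_add)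
  moreover have "P \<in> dyadic_intervals" by (auto simp: P_def dyadic_intervals_def)
  moreover from calculation have "I \<subseteq> P"
    using j dyadic_intervals_len_pos[OF I]
    by (intro dyadic_intervals_subset_if_len_le[OF I _ \<open>x \<in> I\<close>]) (simp_all add: P_def)
  ultimately show ?thesis by (intro that)
qed

text \<open>Every normalised indicator has integral 1, so integration over the line adds up the
  masses of the top halves. The support condition confines the sum to the tiling of Q_I.\<close>

lemma nn_integral_dyadic_balayage:
  assumes sets: "sets \<nu> = sets (restrict_space borel upper_half_plane)"
    and I: "I \<in> dyadic_intervals"
    and supp: "\<And>K. K \<in> dyadic_intervals \<Longrightarrow> \<not> K \<subseteq> I \<Longrightarrow> emeasure \<nu> (top_half K) = 0"
  shows "(\<integral>\<^sup>+t. dyadic_balayage \<nu> t \<partial>lborel) = emeasure \<nu> (carleson_square I)"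
    and "t \<notin> I \<Longrightarrow> dyadic_balayage \<nu> t = 0"
proof -
  interpret count: sigma_finite_measure "count_space dyadic_intervals"
    by (rule sigma_finite_measure_count_space_countable) (rule countable_dyadic_intervals)
  interpret P: pair_sigma_finite "count_space dyadic_intervals" lborel ..
  have meas: "(\<lambda>t. indicator K t / ennreal (len K) * emeasure \<nu> (top_half K)) \<in> borel_measurable lborel"
    if "K \<in> dyadic_intervals" for K
    using dyadic_intervals_borel[OF that] by measurable
  have "(\<integral>\<^sup>+t. dyadic_balayage \<nu> t \<partial>lborel) = (\<integral>\<^sup>+K. (\<integral>\<^sup>+t. indicator K t / ennreal (len K)
      * emeasure \<nu> (top_half K) \<partial>lborel) \<partial>count_space dyadic_intervals)"
    unfolding dyadic_balayage_eq_nn_integral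
    by (rule P.Fubini', rule measurable_pair_measure_countable1[OF countable_dyadic_intervals])
      (simp only: prod.case meas)
  also have "\<dots> = (\<integral>\<^sup>+K. (if K \<subseteq> I then emeasure \<nu> (top_half K) else 0) \<partial>count_space dyadic_intervals)"
  proof (rule nn_integral_cong)
    fix K assume "K \<in> space (count_space dyadic_intervals)"
    then have K: "K \<in> dyadic_intervals" by simp
    have [measurable]: "K \<in> sets borel" using K by (rule dyadic_intervals_borel)
    have "(\<integral>\<^sup>+t. indicator K t / ennreal (len K) * emeasure \<nu> (top_half K) \<partial>lborel)
        = ennreal (len K) / ennreal (len K) * emeasure \<nu> (top_half K)"
      using K dyadic_intervals_subset
      by (simp add: nn_integral_multc nn_integral_divide emeasure_interval_eq_len subset_iff)
    then show "(\<integral>\<^sup>+t. indicator K t / ennreal (len K) * emeasure \<nu> (top_half K) \<partial>lborel)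
        = (if K \<subseteq> I then emeasure \<nu> (top_half K) else 0)"
      using K dyadic_intervals_len_pos[OF K] supp[OF K] by (simp add: ennreal_divide_self)
  qed
  also have "\<dots> = emeasure \<nu> (carleson_square I)"
    using sets I by (rule nn_integral_top_half)
  finally show "(\<integral>\<^sup>+t. dyadic_balayage \<nu> t \<partial>lborel) = emeasure \<nu> (carleson_square I)" .
  show "dyadic_balayage \<nu> t = 0" if "t \<notin> I"
  proof -
    have "dyadic_balayage \<nu> t = (\<integral>\<^sup>+K. 0 \<partial>count_space dyadic_intervals)"
      unfolding dyadic_balayage_eq_nn_integral
    proof (rule nn_integral_cong)
      fix K assume "K \<in> space (count_space dyadic_intervals)"
      then have K: "K \<in> dyadic_intervals" by simp
      show "indicator K t / ennreal (len K) * emeasure \<nu> (top_half K) = 0"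
        using that supp[OF K] by (cases "K \<subseteq> I") (auto simp: indicator_def)
    qed
    then show ?thesis by simp
  qed
qed

text \<open>On \<open>P - I\<close>, half of \<open>P\<close>, the function vanishes and deviates
  from its mean \<open>m\<close> by exactly \<open>m\<close>. Hence m^2 / 2 is at most d^2, so m is
  at most 2 d, while the integral of \<open>f\<close> is m |P| = 2 m |I|.\<close>

lemma nn_integral_le_dyadic_osc_ext:
  assumes P: "P \<in> intervals" and I: "I \<in> intervals" "I \<subseteq> P" "len P = 2 * len I"
    and f[measurable]: "f \<in> borel_measurable lborel"
    and f0: "\<And>t. t \<notin> I \<Longrightarrow> f t = 0"
    and osc: "dyadic_osc_ext f P \<le> ennreal (d\<^sup>2)" and "d \<ge> 0"
  shows "(\<integral>\<^sup>+t. f t \<partial>lborel) \<le> ennreal (4 * d * len I)"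
proof -
  have [measurable]: "I \<in> sets borel" "P \<in> sets borel" using I P by (auto intro: intervals_borel)
  have len: "len I > 0" using I by (intro intervals_len_pos)
  have ePI: "emeasure lborel (P - I) = ennreal (len I)"
    using P I len by (subst emeasure_Diff) (auto simp: emeasure_interval_eq_len ennreal_minus)
  \<comment> \<open>The convention that the constant infinity has oscillation 0 would make the
    hypothesis empty; the zeros on \<open>P - I\<close> exclude this case.\<close>
  have "\<not> (AE t\<in>P in lborel. f t = \<infinity>)"
  proof
    assume "AE t\<in>P in lborel. f t = \<infinity>"
    then have "AE t in lborel. t \<notin> P - I"
    proof eventually_elim
      case (elim t)
      then show ?case using f0[of t] by (cases "t \<in> I") auto
    qed
    then have "emeasure lborel (P - I) = 0"
      by (subst (asm) AE_iff_measurable[OF _ refl]) (auto simp: set_diff_eq)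
    then show False using ePI len by simp
  qed
  then have fin: "AE t\<in>P in lborel. f t < \<infinity>"
    and mosc: "mean_osc 2 (\<lambda>t. enn2real (f t)) P \<le> ennreal (d\<^sup>2)"
    using osc by (auto simp: dyadic_osc_ext_def top_unique split: if_splits)
  then have set_int: "set_integrable lborel P (\<lambda>t. enn2real (f t))"
    and osc2: "(\<integral>\<^sup>+t\<in>P. ennreal (\<bar>enn2real (f t) - mean (\<lambda>t. enn2real (f t)) P\<bar>\<^sup>2) \<partial>lborel)
        / ennreal (len P) \<le> ennreal (d\<^sup>2)"
    by (auto simp: mean_osc_def top_unique split: if_splits)
  define m where "m = mean (\<lambda>t. enn2real (f t)) P"
  have m_eq: "(LINT t:P|lborel. enn2real (f t)) = 2 * m * len I"
    using len I by (simp add: m_def mean_def)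
  have "m \<ge> 0"
    unfolding m_def mean_def set_lebesgue_integral_def by simp
  have "(\<integral>\<^sup>+t. f t \<partial>lborel) = (\<integral>\<^sup>+t. ennreal (indicat_real P t *\<^sub>R enn2real (f t)) \<partial>lborel)"
    using fin
    by (intro nn_integral_cong_AE, eventually_elim) (use f0 I in \<open>auto simp: indicator_def\<close>)
  also have "\<dots> = ennreal (2 * m * len I)"
    using set_int unfolding set_integrable_def m_eq[symmetric] set_lebesgue_integral_def
    by (intro nn_integral_eq_integral) auto
  finally have int_f: "(\<integral>\<^sup>+t. f t \<partial>lborel) = ennreal (2 * m * len I)" .
  have "ennreal (m\<^sup>2 / 2) = ennreal (m\<^sup>2) * ennreal (len I) / ennreal (len P)"
    using len I by (simp add: divide_ennreal flip: ennreal_mult)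
  also have "\<dots> = (\<integral>\<^sup>+t. ennreal (m\<^sup>2) * indicator (P - I) t \<partial>lborel) / ennreal (len P)"
    by (simp add: nn_integral_cmult_indicator ePI)
  also have "\<dots> \<le> (\<integral>\<^sup>+t\<in>P. ennreal (\<bar>enn2real (f t) - m\<bar>\<^sup>2) \<partial>lborel) / ennreal (len P)"
    by (intro divide_right_mono_ennreal nn_integral_mono) (auto simp: f0 indicator_def)
  also have "\<dots> \<le> ennreal (d\<^sup>2)" using osc2 by (simp add: m_def)
  finally have "m\<^sup>2 \<le> 2 * d\<^sup>2" by (simp add: ennreal_le_iff)
  also have "\<dots> \<le> (2 * d)\<^sup>2" by (simp add: power_mult_distrib)
  finally have "m \<le> 2 * d" by (rule power2_le_imp_le) (use \<open>d \<ge> 0\<close> in simp)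
  then have "2 * m * len I \<le> 4 * d * len I" using len by simp
  then show ?thesis unfolding int_f by (rule ennreal_leI)
qed

lemma upper_half_plane_borel: "upper_half_plane \<in> sets borel"
proof -
  have eq: "upper_half_plane = UNIV \<times> {0<..}" by (auto simp: upper_half_plane_def)
  show ?thesis unfolding eq by (intro borel_Times) simp_all
qed

lemma Carl_le_dyadic_bmo_norm:
  assumes \<mu>: "regular_borel_measure \<mu>"
    and D: "\<And>E. E \<in> sets borel \<Longrightarrow> E \<subseteq> upper_half_plane \<Longrightarrow>
        dyadic_bmo_norm_ext (dyadic_balayage (measure_restriction \<mu> E)) \<le> D"
  shows "Carl \<mu> \<le> ennreal 4 * D"
proof (rule Carl_le)
  have sets: "sets \<mu> = sets (restrict_space borel upper_half_plane)"
    using \<mu> by (simp add: regular_borel_measure_def)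
  fix I assume I: "I \<in> dyadic_intervals"
  then have I': "I \<in> intervals" using dyadic_intervals_subset by blast
  have len: "len I > 0" using I' by (rule intervals_len_pos)
  define Q where "Q = carleson_square I"
  define \<nu> where "\<nu> = measure_restriction \<mu> Q"
  have "Q \<in> sets (restrict_space borel upper_half_plane)"
    unfolding Q_def using I' by (rule carleson_square_measurable)
  then have Q: "Q \<in> sets borel" "Q \<subseteq> upper_half_plane" "Q \<in> sets \<mu>"
    using upper_half_plane_borel by (auto simp: sets sets_restrict_space)
  have sets_\<nu>: "sets \<nu> = sets (restrict_space borel upper_half_plane)"
    by (simp add: \<nu>_def sets_measure_restriction sets)
  have supp: "emeasure \<nu> (top_half K) = 0" if K: "K \<in> dyadic_intervals" "\<not> K \<subseteq> I" for K
  proof -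
    \<comment> \<open>Q_I is tiled by top halves of subintervals of \<open>I\<close>, and distinct
      top halves are disjoint.\<close>
    have "Q \<inter> top_half K = {}"
      using K I top_half_inter_eq
      unfolding Q_def carleson_square_eq_UN_top_half[OF I] by blast
    then show ?thesis
      unfolding \<nu>_def using Q top_half_measurable[of K] K dyadic_intervals_subset
      by (subst emeasure_measure_restriction) (auto simp: sets)
  qed
  define f where "f = dyadic_balayage \<nu>"
  have int_f: "(\<integral>\<^sup>+t. f t \<partial>lborel) = emeasure \<mu> Q"
    using nn_integral_dyadic_balayage(1)[OF sets_\<nu> I supp] Q
    unfolding f_def Q_def[symmetric] by (simp add: \<nu>_def emeasure_measure_restriction)
  have f0: "f t = 0" if "t \<notin> I" for t
    unfolding f_def using nn_integral_dyadic_balayage(2)[OF sets_\<nu> I supp that] .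
  have fD: "dyadic_bmo_norm_ext f \<le> D" unfolding f_def \<nu>_def using Q by (intro D)
  show "emeasure \<mu> (carleson_square I) \<le> ennreal 4 * D * ennreal (len I)"
  proof (cases D)
    case (real d)
    obtain P where P: "P \<in> dyadic_intervals" "I \<subseteq> P" "len P = 2 * len I"
      using I by (rule dyadic_parent)
    have "(SUP I\<in>dyadic_intervals. dyadic_osc_ext f I) \<le> ennreal (d\<^sup>2)"
      using fD real by (simp add: dyadic_bmo_norm_ext_def ennreal_sqrt_le_iff)
    then have "dyadic_osc_ext f P \<le> ennreal (d\<^sup>2)"
      using SUP_upper[OF P(1)] by (rule order_trans[rotated])
    then have "(\<integral>\<^sup>+t. f t \<partial>lborel) \<le> ennreal (4 * d * len I)"
      using P I' f0 real dyadic_intervals_subset borel_measurable_dyadic_balayage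
      by (intro nn_integral_le_dyadic_osc_ext) (auto simp: f_def)
    then show ?thesis
      using real len by (simp add: int_f Q_def[symmetric] ennreal_mult)
  qed (use len in \<open>simp add: ennreal_mult_top ennreal_top_mult\<close>)
qed simp

section \<open>The Poisson kernel\<close>

lemma poisson_kernel_nonneg: "0 < y \<Longrightarrow> 0 \<le> poisson_kernel x y t"
  by (simp add: poisson_kernel_def)

lemma measurable_poisson_kernel[measurable (raw)]:
  assumes [measurable]: "f \<in> borel_measurable M" "g \<in> borel_measurable M" "h \<in> borel_measurable M"
  shows "(\<lambda>w. poisson_kernel (f w) (g w) (h w)) \<in> borel_measurable M"
  unfolding poisson_kernel_def by measurable

text \<open>The primitive arctan((t - x)/y)/pi increases from 0 at \<open>x\<close> to 1/2 at
  infinity.\<close>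

lemma nn_integral_poisson_kernel_half:
  assumes "0 < y"
  shows "(\<integral>\<^sup>+t. ennreal (poisson_kernel x y t) * indicator {x..} t \<partial>lborel) = ennreal (1 / 2)"
proof -
  have "(\<integral>\<^sup>+t. ennreal (poisson_kernel x y t) * indicator {x..} t \<partial>lborel)
      = ennreal (1 / 2 - arctan ((x - x) / y) / pi)"
  proof (rule nn_integral_FTC_atLeast[where F = "\<lambda>t. arctan ((t - x) / y) / pi"])
    fix t
    have "((\<lambda>t. arctan ((t - x) / y) / pi) has_real_derivative
        inverse (1 + ((t - x) / y)\<^sup>2) * (1 / y) / pi) (at t)"
      using assms by (auto intro!: derivative_eq_intros)
    moreover have "inverse (1 + ((t - x) / y)\<^sup>2) * (1 / y) / pi = poisson_kernel x y t"
      using assms unfolding poisson_kernel_def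
      by (simp add: divide_simps power2_eq_square sum_power2_eq_zero_iff)
    ultimately show "((\<lambda>t. arctan ((t - x) / y) / pi) has_real_derivative poisson_kernel x y t) (at t)"
      by simp
  next
    have "filterlim (\<lambda>t. 1 / y * (- x + t)) at_top at_top"
      using assms
      by (intro filterlim_tendsto_pos_mult_at_top[OF tendsto_const]
          filterlim_tendsto_add_at_top[OF tendsto_const] filterlim_ident) auto
    then have "filterlim (\<lambda>t. (t - x) / y) at_top at_top" by simp
    then have "((\<lambda>t. arctan ((t - x) / y)) \<longlongrightarrow> pi / 2) at_top"
      by (rule filterlim_compose[OF tendsto_arctan_at_top])
    then have "((\<lambda>t. arctan ((t - x) / y) / pi) \<longlongrightarrow> (pi / 2) / pi) at_top"
      by (intro tendsto_divide tendsto_const) auto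
    then show "((\<lambda>t. arctan ((t - x) / y) / pi) \<longlongrightarrow> 1 / 2) at_top" by simp
  qed (use assms poisson_kernel_nonneg in auto)
  then show ?thesis by simp
qed

lemma nn_integral_poisson_kernel:
  assumes "0 < y"
  shows "(\<integral>\<^sup>+t. ennreal (poisson_kernel x y t) \<partial>lborel) = 1"
proof -
  \<comment> \<open>Reflection about \<open>x\<close> carries one half-line to the other up to the
    point \<open>x\<close> itself, hence the almost everywhere equality below.\<close>
  have "(\<integral>\<^sup>+t. ennreal (poisson_kernel x y t) * indicator {..<x} t \<partial>lborel)
      = (\<integral>\<^sup>+t. ennreal (poisson_kernel x y (2 * x - t)) * indicator {..<x} (2 * x - t) \<partial>lborel)"
    by (subst nn_integral_real_affine[where c = "-1" and t = "2 * x"]) simp_all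
  also have "\<dots> = (\<integral>\<^sup>+t. ennreal (poisson_kernel x y t) * indicator {x..} t \<partial>lborel)"
  proof (rule nn_integral_cong_AE)
    show "AE t in lborel. ennreal (poisson_kernel x y (2 * x - t)) * indicator {..<x} (2 * x - t) =
        ennreal (poisson_kernel x y t) * indicator {x..} t"
      using AE_lborel_singleton[of x]
      by eventually_elim (auto simp: poisson_kernel_def indicator_def power2_commute)
  qed
  finally have left: "(\<integral>\<^sup>+t. ennreal (poisson_kernel x y t) * indicator {..<x} t \<partial>lborel) = ennreal (1 / 2)"
    unfolding nn_integral_poisson_kernel_half[OF assms] .
  have "(\<integral>\<^sup>+t. ennreal (poisson_kernel x y t) \<partial>lborel)
      = (\<integral>\<^sup>+t. ennreal (poisson_kernel x y t) * indicator {..<x} t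
          + ennreal (poisson_kernel x y t) * indicator {x..} t \<partial>lborel)"
    by (intro nn_integral_cong) (auto simp: indicator_def)
  also have "\<dots> = (\<integral>\<^sup>+t. ennreal (poisson_kernel x y t) * indicator {..<x} t \<partial>lborel)
      + (\<integral>\<^sup>+t. ennreal (poisson_kernel x y t) * indicator {x..} t \<partial>lborel)"
    by (rule nn_integral_add) measurable
  also have "\<dots> = ennreal (1 / 2 + 1 / 2)"
    unfolding left nn_integral_poisson_kernel_half[OF assms] by (rule ennreal_plus[symmetric]) auto
  finally show ?thesis by simp
qed

text \<open>With \<zeta> = a + i r this is, up to a factor 2 in the denominator, Im \<zeta> divided
  by the squared distance from \<open>z\<close> to the conjugate of \<zeta>: the kernel of the usual
  integral test for Carleson measures. It is of size 1/r on the box of scale \<open>r\<close> over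
  \<open>a\<close> and decays quadratically beyond.\<close>

definition carleson_decay :: "real \<Rightarrow> real \<Rightarrow> real \<times> real \<Rightarrow> real" where
  "carleson_decay a r z = r / (r\<^sup>2 + (fst z - a)\<^sup>2 + (snd z)\<^sup>2)"

lemma measurable_carleson_decay[measurable (raw)]:
  assumes [measurable]: "f \<in> borel_measurable M" "g \<in> borel_measurable M"
    "(\<lambda>w. fst (h w)) \<in> borel_measurable M" "(\<lambda>w. snd (h w)) \<in> borel_measurable M"
  shows "(\<lambda>w. carleson_decay (f w) (g w) (h w)) \<in> borel_measurable M"
  unfolding carleson_decay_def by measurable

lemma carleson_decay_nonneg: "0 \<le> r \<Longrightarrow> 0 \<le> carleson_decay a r z"
  by (simp add: carleson_decay_def)

lemma divide_pi_le: "c / pi \<le> c / 3" if "0 \<le> c"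
  using that pi_gt3 by (intro divide_left_mono) auto

lemma frac_le_if_mult_le:
  fixes a b c k :: real
  assumes "0 < b" "0 < c" "c \<le> k * b" "0 \<le> a"
  shows "a / b \<le> k * (a / c)"
proof -
  have "a * c \<le> a * (k * b)" using assms by (intro mult_left_mono)
  then show ?thesis using assms by (simp add: field_simps)
qed

text \<open>At every \<open>t\<close> at least one of the two kernels is at most twice the decay
  kernel, whose scale is the greater height \<open>y\<close>. Bounding that factor leaves the other
  one, which has integral 1 in \<open>t\<close>.\<close>

lemma poisson_kernel_mult_le:
  assumes y: "0 < y'" "y' \<le> y"
  shows "poisson_kernel x y t * poisson_kernel x' y' t
    \<le> 2 * carleson_decay x y (x', y') * (poisson_kernel x y t + poisson_kernel x' y' t)"
proof -
  have "0 < y" using y by simp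
  define u v W where "u = t - x" and "v = t - x'" and "W = y\<^sup>2 + (x' - x)\<^sup>2 + y'\<^sup>2"
  define \<rho> where "\<rho> = carleson_decay x y (x', y')"
  have \<rho>: "\<rho> = y / W" by (simp add: \<rho>_def carleson_decay_def W_def)
  have "W > 0" using \<open>0 < y\<close> by (simp add: W_def add_pos_nonneg)
  have yy: "y'\<^sup>2 \<le> y\<^sup>2" using y by (intro power_mono) auto
  have "0 \<le> (u + v)\<^sup>2" by simp
  then have "(x' - x)\<^sup>2 \<le> 2 * u\<^sup>2 + 2 * v\<^sup>2"
    by (simp add: u_def v_def power2_eq_square algebra_simps)
  then have W: "W \<le> 2 * y\<^sup>2 + 2 * u\<^sup>2 + 2 * v\<^sup>2" using yy by (simp add: W_def)
  have pz: "poisson_kernel x y t = (y / (y\<^sup>2 + u\<^sup>2)) / pi"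
    by (simp add: poisson_kernel_def u_def)
  have pw: "poisson_kernel x' y' t = (y' / (y'\<^sup>2 + v\<^sup>2)) / pi"
    by (simp add: poisson_kernel_def v_def)
  have *: "q / pi \<le> 2 * \<rho>" if "q \<le> 6 * \<rho>" "0 \<le> q" for q
    using divide_pi_le[OF that(2)] that(1) by linarith
  \<comment> \<open>If \<open>t\<close> is horizontally at least as far from \<open>x\<close> as
    from \<open>x'\<close>, the higher point has the small kernel. Otherwise the lower point has it
    when \<open>v\<close> exceeds \<open>y\<close>, and when \<open>v\<close> is at most
    \<open>y\<close> the height \<open>y\<close> alone makes the kernel of the higher point small.
    The 6 in each case becomes 2 through 1/pi < 1/3.\<close>
  consider "v\<^sup>2 \<le> u\<^sup>2" | "u\<^sup>2 \<le> v\<^sup>2" "y\<^sup>2 \<le> v\<^sup>2" | "u\<^sup>2 \<le> v\<^sup>2" "v\<^sup>2 \<le> y\<^sup>2" by linarith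
  then have "poisson_kernel x y t \<le> 2 * \<rho> \<or> poisson_kernel x' y' t \<le> 2 * \<rho>"
  proof cases
    case 1
    then have "W \<le> 6 * (y\<^sup>2 + u\<^sup>2)"
      using W zero_le_power2[of y] zero_le_power2[of u] unfolding distrib_left by linarith
    then have "y / (y\<^sup>2 + u\<^sup>2) \<le> 6 * \<rho>"
      unfolding \<rho> using \<open>W > 0\<close> \<open>0 < y\<close> by (intro frac_le_if_mult_le) (auto simp: add_pos_nonneg)
    then show ?thesis unfolding pz using \<open>0 < y\<close> by (intro disjI1 *) auto
  next
    case 2
    then have "W \<le> 6 * (y'\<^sup>2 + v\<^sup>2)"
      using W zero_le_power2[of y'] unfolding distrib_left by linarith
    then have "y' / (y'\<^sup>2 + v\<^sup>2) \<le> 6 * (y' / W)"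
      using \<open>W > 0\<close> y by (intro frac_le_if_mult_le) (auto simp: add_pos_nonneg)
    also have "\<dots> \<le> 6 * \<rho>"
      unfolding \<rho> using \<open>W > 0\<close> y by (simp add: divide_right_mono)
    finally show ?thesis unfolding pw using y by (intro disjI2 *) auto
  next
    case 3
    then have "W \<le> 6 * (y\<^sup>2 + u\<^sup>2)"
      using W zero_le_power2[of y] zero_le_power2[of u] unfolding distrib_left by linarith
    then have "y / (y\<^sup>2 + u\<^sup>2) \<le> 6 * \<rho>"
      unfolding \<rho> using \<open>W > 0\<close> \<open>0 < y\<close> by (intro frac_le_if_mult_le) (auto simp: add_pos_nonneg)
    then show ?thesis unfolding pz using \<open>0 < y\<close> by (intro disjI1 *) auto
  qed
  moreover have nonneg: "0 \<le> poisson_kernel x y t" "0 \<le> poisson_kernel x' y' t" "0 \<le> 2 * \<rho>"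
    using y \<open>0 < y\<close> by (auto simp: poisson_kernel_nonneg \<rho>_def carleson_decay_nonneg)
  have "p * q \<le> 2 * \<rho> * (p + q)" if "p \<le> 2 * \<rho>" "0 \<le> p" "0 \<le> q" for p q
  proof -
    have "p * q \<le> 2 * \<rho> * q" using that by (intro mult_right_mono)
    also have "\<dots> \<le> 2 * \<rho> * (p + q)" using that nonneg(3) by (intro mult_left_mono) auto
    finally show ?thesis .
  qed
  ultimately show ?thesis
    unfolding \<rho>_def[symmetric] using nonneg(1,2) by (metis add.commute mult.commute)
qed

text \<open>The difference of the kernels gains a factor |t - a|, at most \<open>r\<close>, and what
  is left is absorbed by 2 y |s| \<le> y^2 + s^2 into half the sum of 1/U and 1/V. For a far point
  both denominators are comparable with \<open>W\<close>. The constant is 8/pi, rounded up to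
  3.\<close>

lemma poisson_kernel_diff_le:
  assumes y: "0 < y" and r: "0 < r" and t: "\<bar>t - a\<bar> \<le> r"
    and far: "\<not> (\<bar>x - a\<bar> \<le> 2 * r \<and> y \<le> 4 * r)"
  shows "\<bar>poisson_kernel x y t - poisson_kernel x y a\<bar> \<le> 3 * carleson_decay a r (x, y)"
proof -
  define U V W where "U = y\<^sup>2 + (t - x)\<^sup>2" and "V = y\<^sup>2 + (a - x)\<^sup>2" and "W = r\<^sup>2 + (x - a)\<^sup>2 + y\<^sup>2"
  have pos: "0 < U" "0 < V" "0 < W"
    using y r by (simp_all add: U_def V_def W_def add_pos_nonneg)
  have four: "(2::real)\<^sup>2 = 4" by simp
  have r2: "(c * r)\<^sup>2 \<le> s\<^sup>2" if "c * r \<le> \<bar>s\<bar>" "0 \<le> c" for c s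
    using that r by (simp add: abs_le_square_iff[symmetric])
  \<comment> \<open>If x is at horizontal distance at least 2 r from \<open>a\<close>, moving from
    \<open>a\<close> to \<open>t\<close> at most halves that distance. Otherwise y \<ge> 4 r, and
    the height dominates all terms of \<open>W\<close>.\<close>
  have WU: "W \<le> 8 * U" and WV: "W \<le> 8 * V"
  proof -
    consider "2 * r \<le> \<bar>x - a\<bar>" | "\<bar>x - a\<bar> \<le> 2 * r" "4 * r \<le> y" using far by linarith
    then have "W \<le> 8 * U \<and> W \<le> 8 * V"
    proof cases
      case 1
      moreover have "\<bar>x - a\<bar> \<le> \<bar>t - a\<bar> + \<bar>t - x\<bar>" by linarith
      moreover have "p \<le> 2 * q" if "2 * r \<le> p" "p \<le> s + q" "s \<le> r" for p q s
        using that by linarith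
      ultimately have "\<bar>x - a\<bar> \<le> 2 * \<bar>t - x\<bar>" using t by blast
      then have "\<bar>x - a\<bar> \<le> \<bar>2 * (t - x)\<bar>" by (simp only: abs_mult abs_numeral)
      then have "(x - a)\<^sup>2 \<le> 2\<^sup>2 * (t - x)\<^sup>2"
        by (simp only: abs_le_square_iff power_mult_distrib)
      moreover have "2\<^sup>2 * r\<^sup>2 \<le> (x - a)\<^sup>2"
        using r2[of 2 "x - a"] 1 by (simp only: power_mult_distrib)
      moreover have "(a - x)\<^sup>2 = (x - a)\<^sup>2" by (rule power2_commute)
      moreover have "r' + x' + y' \<le> 8 * (y' + t') \<and> r' + x' + y' \<le> 8 * (y' + x')"
        if "x' \<le> 4 * t'" "4 * r' \<le> x'" "0 \<le> y'" "0 \<le> r'" for r' x' y' t' :: real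
        using that by auto
      ultimately show ?thesis
        unfolding U_def V_def W_def four by (metis zero_le_power2)
    next
      case 2
      have "16 * r\<^sup>2 \<le> y\<^sup>2" using r2[of 4 y] 2 by (simp add: power_mult_distrib)
      moreover have "(x - a)\<^sup>2 \<le> 4 * r\<^sup>2"
        using 2 r abs_le_square_iff[of "x - a" "2 * r"] by (simp add: power_mult_distrib)
      moreover have "r' + x' + y' \<le> 8 * (y' + t') \<and> r' + x' + y' \<le> 8 * (y' + a')"
        if "16 * r' \<le> y'" "x' \<le> 4 * r'" "0 \<le> t'" "0 \<le> r'" "0 \<le> a'" for r' x' y' t' a' :: real
        using that by auto
      ultimately show ?thesis
        unfolding U_def V_def W_def by (metis zero_le_power2)
    qed
    then show "W \<le> 8 * U" "W \<le> 8 * V" by auto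
  qed
  have "poisson_kernel x y t - poisson_kernel x y a = (y / U - y / V) / pi"
    by (simp add: poisson_kernel_def U_def V_def diff_divide_distrib mult.commute)
  \<comment> \<open>V - U is a difference of the squares of a - x and t - x, and the difference of
    these two numbers is a - t.\<close>
  also have "y / U - y / V = (a - t) * (y * (a - x) + y * (t - x)) / (U * V)"
    using pos by (simp add: divide_simps) (simp add: U_def V_def power2_eq_square algebra_simps)
  finally have eq: "\<bar>poisson_kernel x y t - poisson_kernel x y a\<bar>
      = \<bar>a - t\<bar> * \<bar>y * (a - x) + y * (t - x)\<bar> / (U * V) / pi"
    using pos by (simp add: abs_mult)
  have amgm: "\<bar>y * s\<bar> \<le> (y\<^sup>2 + s\<^sup>2) / 2" for s
  proof -
    have "0 \<le> (y - \<bar>s\<bar>)\<^sup>2" by simp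
    then show ?thesis using y by (simp add: power2_eq_square algebra_simps abs_mult)
  qed
  have "\<bar>y * (a - x) + y * (t - x)\<bar> \<le> (U + V) / 2"
    using abs_triangle_ineq[of "y * (a - x)" "y * (t - x)"] amgm[of "a - x"] amgm[of "t - x"] by (simp add: U_def V_def)
  then have "\<bar>a - t\<bar> * \<bar>y * (a - x) + y * (t - x)\<bar> \<le> r * ((U + V) / 2)"
    using t r by (intro mult_mono) auto
  then have "\<bar>a - t\<bar> * \<bar>y * (a - x) + y * (t - x)\<bar> / (U * V) \<le> r * ((U + V) / 2) / (U * V)"
    using pos by (intro divide_right_mono) auto
  also have "\<dots> = r / U / 2 + r / V / 2"
    using pos by (simp add: field_simps)
  also have "\<dots> \<le> 8 * (r / W)"
    using frac_le_if_mult_le[OF pos(1,3) WU less_imp_le[OF r]]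
      frac_le_if_mult_le[OF pos(2,3) WV less_imp_le[OF r]]
    by simp
  finally have "\<bar>poisson_kernel x y t - poisson_kernel x y a\<bar> \<le> 8 * (r / W) / pi"
    unfolding eq by (intro divide_right_mono) auto
  also have "\<dots> \<le> 8 * (r / W) / 3"
    using r pos by (intro divide_pi_le) auto
  also have "\<dots> \<le> 3 * (r / W)"
  proof -
    have "8 * q / 3 \<le> 3 * q" if "0 \<le> q" for q :: real using that by simp
    then show ?thesis using r pos by (metis divide_nonneg_pos less_imp_le)
  qed
  finally show ?thesis by (simp add: W_def carleson_decay_def)
qed

text \<open>A far point has height or horizontal distance at least \<open>r\<close>. The bound makes
  the comparison constant in \<open>balayage_deviation_le\<close> an integral of a bounded
  function.\<close>

lemma poisson_kernel_centre_le:
  assumes y: "0 < y" and r: "0 < r" and far: "\<not> (\<bar>x - a\<bar> \<le> 2 * r \<and> y \<le> 4 * r)"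
  shows "poisson_kernel x y a \<le> 1 / r"
proof -
  have "y * r \<le> y\<^sup>2 + (a - x)\<^sup>2"
  proof (cases "r \<le> y")
    case True
    then have "y * r \<le> y * y" using y by (intro mult_left_mono) auto
    then show ?thesis by (simp add: power2_eq_square add_increasing2)
  next
    case False
    then have "r\<^sup>2 \<le> (a - x)\<^sup>2" using far r by (simp only: abs_le_square_iff[symmetric]) linarith
    moreover have "y * r \<le> r * r" using False r by (intro mult_right_mono) auto
    ultimately show ?thesis using zero_le_power2[of y] unfolding power2_eq_square[of r] by linarith
  qed
  then have "y / (y\<^sup>2 + (a - x)\<^sup>2) \<le> 1 / r"
    using y r by (simp add: divide_simps add_pos_nonneg mult.commute)
  moreover have "y / (y\<^sup>2 + (a - x)\<^sup>2) / pi \<le> y / (y\<^sup>2 + (a - x)\<^sup>2) / 1"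
    using pi_gt3 y by (intro divide_left_mono) auto
  ultimately show ?thesis by (simp add: poisson_kernel_def mult.commute)
qed

section \<open>Balayage of a finite Carleson measure\<close>

text \<open>Testing \<open>C\<close> on dyadic squares only admits every competitor in the infimum
  defining \<open>Carl\<close>. Finiteness of the mass, true for the restriction to a Carleson
  square, gives integrability; the BMO upper bound depends on \<open>C\<close> alone.\<close>

locale finite_dyadic_carleson =
  fixes \<nu> :: "(real \<times> real) measure" and C :: real
  assumes sets_eq: "sets \<nu> = sets (restrict_space borel upper_half_plane)"
    and C_pos: "0 < C"
    and carleson: "\<And>I. I \<in> dyadic_intervals \<Longrightarrow> emeasure \<nu> (carleson_square I) \<le> ennreal (C * len I)"
    and finite: "emeasure \<nu> (space \<nu>) < \<infinity>"
begin

sublocale finite_measure \<nu>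
  using finite by (intro finite_measureI) auto

lemma space_eq: "space \<nu> = upper_half_plane"
  using sets_eq_imp_space_eq[OF sets_eq] by (simp add: space_restrict_space)

lemma snd_pos: "z \<in> space \<nu> \<Longrightarrow> 0 < snd z"
  by (auto simp: space_eq upper_half_plane_def)

lemma sets_I: "A \<in> sets borel \<Longrightarrow> A \<subseteq> upper_half_plane \<Longrightarrow> A \<in> sets \<nu>"
  using upper_half_plane_borel by (auto simp: sets_eq sets_restrict_space)

lemma measurable_fst_snd [measurable]:
  "(\<lambda>z. fst z) \<in> borel_measurable \<nu>" "(\<lambda>z. snd z) \<in> borel_measurable \<nu>"
proof -
  have "f \<in> borel_measurable \<nu>" if "f \<in> borel_measurable borel" for f :: "real \<times> real \<Rightarrow> real"
    using measurable_restrict_space1[OF that] measurable_cong_sets[OF sets_eq refl] by blast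
  moreover have "(\<lambda>z :: real \<times> real. fst z) \<in> borel_measurable borel"
    "(\<lambda>z :: real \<times> real. snd z) \<in> borel_measurable borel"
    by (intro borel_measurable_continuous_onI continuous_on_fst continuous_on_snd continuous_on_id)+
  ultimately show "(\<lambda>z. fst z) \<in> borel_measurable \<nu>" "(\<lambda>z. snd z) \<in> borel_measurable \<nu>"
    by blast+
qed

lemma measurable_fst_snd_compose [measurable (raw)]:
  assumes "g \<in> measurable M \<nu>"
  shows "(\<lambda>w. fst (g w)) \<in> borel_measurable M" "(\<lambda>w. snd (g w)) \<in> borel_measurable M"
  using measurable_compose[OF assms measurable_fst_snd(1)]
    measurable_compose[OF assms measurable_fst_snd(2)] by auto

text \<open>The base of the box meets only two adjacent dyadic intervals of comparable length.\<close>

lemma emeasure_box_le: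
  assumes "0 < s"
  shows "emeasure \<nu> {z. \<bar>fst z - a\<bar> \<le> s \<and> 0 < snd z \<and> snd z \<le> 2 * s} \<le> ennreal (8 * C * s)"
proof -
  \<comment> \<open>The length lies between 2 s, the width and height of the box, and 4 s. Two
    squares of mass at most 4 C s each give 8 C s.\<close>
  obtain n :: int where n: "2 powi n / 2 < 2 * s" "2 * s \<le> 2 powi n"
    using ex_powi_2_bracket[of "2 * s"] assms by auto
  obtain k :: int where k: "a - s \<in> {of_int k * 2 powi n <.. (of_int k + 1) * 2 powi n}"
    by (rule dyadic_cover)
  define K where "K j = {of_int j * 2 powi n <.. (of_int j + 1) * (2::real) powi n}" for j :: int
  have K: "K j \<in> dyadic_intervals" for j by (auto simp: K_def dyadic_intervals_def)
  have lenK: "len (K j) = 2 powi n" for j by (simp add: K_def algebra_simps)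
  have Q: "carleson_square (K j) \<in> sets \<nu>" for j
    using K carleson_square_measurable dyadic_intervals_subset sets_eq by blast
  have sub: "{z. \<bar>fst z - a\<bar> \<le> s \<and> 0 < snd z \<and> snd z \<le> 2 * s}
      \<subseteq> carleson_square (K k) \<union> carleson_square (K (k + 1))"
  proof
    fix z assume "z \<in> {z. \<bar>fst z - a\<bar> \<le> s \<and> 0 < snd z \<and> snd z \<le> 2 * s}"
    then have z: "\<bar>fst z - a\<bar> \<le> s" "0 < snd z" "snd z \<le> 2 powi n" using n by auto
    have "of_int k * 2 powi n < fst z" using k z by auto
    moreover have "fst z \<le> (of_int k + 2) * 2 powi n"
    proof -
      have "fst z \<le> a - s + 2 * s" using z(1) by linarith
      also have "\<dots> \<le> (of_int k + 1) * 2 powi n + 2 powi n" using k n by (intro add_mono) auto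
      finally show ?thesis by (simp add: algebra_simps)
    qed
    ultimately have "fst z \<in> K k \<or> fst z \<in> K (k + 1)"
      by (auto simp: K_def algebra_simps)
    then show "z \<in> carleson_square (K k) \<union> carleson_square (K (k + 1))"
      using z by (cases z) (auto simp: carleson_square_def lenK)
  qed
  have "emeasure \<nu> {z. \<bar>fst z - a\<bar> \<le> s \<and> 0 < snd z \<and> snd z \<le> 2 * s}
      \<le> emeasure \<nu> (carleson_square (K k) \<union> carleson_square (K (k + 1)))"
    using Q by (intro emeasure_mono sub) auto
  also have "\<dots> \<le> emeasure \<nu> (carleson_square (K k)) + emeasure \<nu> (carleson_square (K (k + 1)))"
    using Q by (intro emeasure_subadditive)
  also have "\<dots> \<le> ennreal (C * 2 powi n) + ennreal (C * 2 powi n)"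
    using carleson[OF K] by (intro add_mono) (simp_all add: lenK)
  also have "\<dots> = ennreal (C * 2 powi n + C * 2 powi n)"
    using C_pos by (intro ennreal_plus[symmetric]) auto
  also have "\<dots> \<le> ennreal (8 * C * s)"
  proof (rule ennreal_leI)
    have "C * 2 powi n \<le> C * (4 * s)" using C_pos n by (intro mult_left_mono) auto
    then show "C * 2 powi n + C * 2 powi n \<le> 8 * C * s" by simp
  qed
  finally show ?thesis .
qed

text \<open>Between the boxes of scale 2^(k-1) r and 2^k r the kernel is at most 4 * 4^(-k) / r,
  while the larger box has mass at most 8 C 2^k r. The products form the geometric series 32 C
  2^(-k), with sum 64 C.\<close>

lemma nn_integral_carleson_decay_le:
  assumes r: "0 < r"
  shows "(\<integral>\<^sup>+z. ennreal (carleson_decay a r z) \<partial>\<nu>) \<le> ennreal (64 * C)"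
proof -
  define Q where "Q k = {z :: real \<times> real. \<bar>fst z - a\<bar> \<le> 2 ^ k * r \<and> 0 < snd z \<and> snd z \<le> 2 * (2 ^ k * r)}"
    for k :: nat
  have Q: "Q k \<in> sets \<nu>" for k
  proof (rule sets_I)
    have "Q k = cball a (2 ^ k * r) \<times> {0<..2 * (2 ^ k * r)}"
      by (auto simp: Q_def dist_real_def abs_minus_commute)
    then show "Q k \<in> sets borel" by (simp only:) (intro borel_Times; simp)
  qed (auto simp: Q_def upper_half_plane_def)
  have pt: "ennreal (carleson_decay a r z)
      \<le> (\<Sum>k. ennreal (4 * (1 / 4) ^ k / r) * indicator (Q k) z)" if z: "z \<in> space \<nu>" for z
  proof -
    have y: "0 < snd z" using z by (rule snd_pos)
    define d where "d = r\<^sup>2 + (fst z - a)\<^sup>2 + (snd z)\<^sup>2"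
    have "d > 0" using r by (simp add: d_def add_pos_nonneg)
    obtain k0 where k0: "(\<bar>fst z - a\<bar> + snd z) / r < 2 ^ k0"
      using real_arch_pow[of 2] by auto
    have ex: "z \<in> Q k0"
    proof -
      have "\<bar>fst z - a\<bar> + snd z < 2 ^ k0 * r" using k0 r by (simp add: pos_divide_less_eq)
      then show ?thesis using y by (auto simp: Q_def)
    qed
    \<comment> \<open>Minimality puts the point outside the preceding box, so one coordinate is
      large and gives the lower bound on the denominator.\<close>
    define k where "k = (LEAST k. z \<in> Q k)"
    have k: "z \<in> Q k" unfolding k_def using ex by (rule LeastI)
    have "carleson_decay a r z \<le> 4 * (1 / 4) ^ k / r"
    proof (cases k)
      case 0
      have "r / d \<le> 1 * (r / r\<^sup>2)"
        using r \<open>d > 0\<close> by (intro frac_le_if_mult_le) (auto simp: d_def)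
      then show ?thesis
        using r by (simp add: 0 carleson_decay_def d_def power2_eq_square)
           (meson divide_right_mono less_imp_le order_trans numeral_One one_le_numeral)
    next
      case (Suc j)
      have "z \<notin> Q j" using not_less_Least[of j "\<lambda>k. z \<in> Q k"] Suc k_def by auto
      then have "2 ^ j * r \<le> \<bar>fst z - a\<bar> \<or> 2 ^ j * r \<le> \<bar>snd z\<bar>"
        using y r by (auto simp: Q_def)
      then have "(2 ^ j * r)\<^sup>2 \<le> (fst z - a)\<^sup>2 \<or> (2 ^ j * r)\<^sup>2 \<le> (snd z)\<^sup>2"
        using r by (simp add: abs_le_square_iff[symmetric])
      moreover have "p \<le> 1 * (u + v + w)" if "p \<le> v \<or> p \<le> w" "0 \<le> u" "0 \<le> v" "0 \<le> w"
        for p u v w :: real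
        using that by auto
      ultimately have "(2 ^ j * r)\<^sup>2 \<le> 1 * d"
        unfolding d_def by (metis zero_le_power2)
      then have "r / d \<le> 1 * (r / (2 ^ j * r)\<^sup>2)"
        using r \<open>d > 0\<close> by (intro frac_le_if_mult_le) auto
      also have "\<dots> = 4 * (1 / 4) ^ k / r"
        using r by (simp add: Suc power_mult_distrib power2_eq_square power_divide field_simps
            flip: power_mult_distrib)
      finally show ?thesis by (simp add: carleson_decay_def d_def)
    qed
    then have "ennreal (carleson_decay a r z) \<le> ennreal (4 * (1 / 4) ^ k / r) * indicator (Q k) z"
      using k by (simp add: ennreal_leI)
    also have "\<dots> \<le> (\<Sum>k. ennreal (4 * (1 / 4) ^ k / r) * indicator (Q k) z)"
    proof -
      have "h k \<le> suminf h" for h :: "nat \<Rightarrow> ennreal"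
        using sum_le_suminf[of h "{k}"] by simp
      then show ?thesis .
    qed
    finally show ?thesis .
  qed
  have "(\<integral>\<^sup>+z. ennreal (carleson_decay a r z) \<partial>\<nu>)
      \<le> (\<integral>\<^sup>+z. (\<Sum>k. ennreal (4 * (1 / 4) ^ k / r) * indicator (Q k) z) \<partial>\<nu>)"
    by (intro nn_integral_mono pt)
  also have "\<dots> = (\<Sum>k. ennreal (4 * (1 / 4) ^ k / r) * emeasure \<nu> (Q k))"
    using Q by (subst nn_integral_suminf) (auto simp: nn_integral_cmult_indicator)
  also have "\<dots> \<le> (\<Sum>k. ennreal (32 * C * (1 / 2) ^ k))"
  proof (rule suminf_le)
    fix k
    have "emeasure \<nu> (Q k) \<le> ennreal (8 * C * (2 ^ k * r))"
      unfolding Q_def using r by (intro emeasure_box_le) auto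
    then have "ennreal (4 * (1 / 4) ^ k / r) * emeasure \<nu> (Q k)
        \<le> ennreal (4 * (1 / 4) ^ k / r) * ennreal (8 * C * (2 ^ k * r))"
      by (rule mult_left_mono) simp
    also have "\<dots> = ennreal (4 * (1 / 4) ^ k / r * (8 * C * (2 ^ k * r)))"
      using r C_pos by (intro ennreal_mult[symmetric]) auto
    also have "4 * (1 / 4) ^ k / r * (8 * C * (2 ^ k * r)) = 32 * C * ((1 / 4) ^ k * 2 ^ k)"
      using r by simp
    also have "(1 / 4) ^ k * 2 ^ k = (1 / 2 :: real) ^ k"
      by (simp flip: power_mult_distrib)
    finally show "ennreal (4 * (1 / 4) ^ k / r) * emeasure \<nu> (Q k) \<le> ennreal (32 * C * (1 / 2) ^ k)" .
  qed auto
  also have "\<dots> = ennreal (64 * C)"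
  proof (rule suminf_ennreal_eq)
    have "(\<lambda>k. (32 * C) * (1 / 2) ^ k) sums ((32 * C) * (1 / (1 - 1 / 2)))"
      by (intro sums_mult geometric_sums) simp
    then show "(\<lambda>k. 32 * C * (1 / 2) ^ k) sums (64 * C)" by simp
  qed (use C_pos in auto)
  finally show ?thesis .
qed

end

section \<open>BMO upper bound for the Poisson balayage\<close>

text \<open>Elements of \<open>intervals\<close> may contain either endpoint or neither; they lie
  between the open and the closed interval from infimum to supremum, which have equal
  length.\<close>

lemma interval_centre:
  assumes I: "I \<in> intervals"
  obtains a r where "0 < r" "I \<subseteq> {a - r..a + r}" "len I = 2 * r"
proof -
  have conn: "is_interval I" and bd: "bounded I" and pos: "0 < len I"
    using I by (auto simp: intervals_def)
  have ne: "I \<noteq> {}" using pos by auto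
  have ba: "bdd_above I" "bdd_below I" using bd by (auto intro: bounded_imp_bdd_above bounded_imp_bdd_below)
  define \<alpha> \<beta> where "\<alpha> = Inf I" and "\<beta> = Sup I"
  have sub: "I \<subseteq> {\<alpha>..\<beta>}"
    using ba by (auto simp: \<alpha>_def \<beta>_def intro: cInf_lower cSup_upper)
  have sup: "{\<alpha><..<\<beta>} \<subseteq> I"
  proof
    fix t assume t: "t \<in> {\<alpha><..<\<beta>}"
    obtain u where "u \<in> I" "u < t"
      using t ne ba by (auto simp: \<alpha>_def cInf_less_iff)
    moreover obtain v where "v \<in> I" "t < v"
      using t ne ba by (auto simp: \<beta>_def less_cSup_iff)
    ultimately show "t \<in> I"
      using conn unfolding is_interval_1 by (meson less_imp_le)
  qed
  have le: "\<alpha> \<le> \<beta>" using sub ne by auto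
  have "ennreal (len I) = emeasure lborel I" by (simp add: emeasure_interval_eq_len[OF I])
  also have "\<dots> \<le> emeasure lborel {\<alpha>..\<beta>}" by (intro emeasure_mono sub) simp
  also have "\<dots> = ennreal (\<beta> - \<alpha>)" using le by simp
  finally have "len I \<le> \<beta> - \<alpha>" using le by (simp add: ennreal_le_iff)
  moreover have "ennreal (\<beta> - \<alpha>) = emeasure lborel {\<alpha><..<\<beta>}" using le by simp
  then have "ennreal (\<beta> - \<alpha>) \<le> ennreal (len I)"
    using emeasure_mono[OF sup, of lborel] intervals_borel[OF I] emeasure_interval_eq_len[OF I] by simp
  then have "\<beta> - \<alpha> \<le> len I" by (simp add: ennreal_le_iff)
  ultimately have "len I = \<beta> - \<alpha>" by simp
  with sub pos show ?thesis by (intro that[of "(\<beta> - \<alpha>) / 2" "(\<alpha> + \<beta>) / 2"]) (auto simp: field_simps)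
qed

text \<open>Replacing the mean by an arbitrary constant costs a factor 2, because the mean itself
  differs from \<open>c\<close> by at most the average of |b - c|.\<close>

lemma mean_osc_1_le:
  assumes I: "I \<in> intervals" and b: "set_integrable lborel I b"
  shows "mean_osc 1 b I \<le> 2 * (\<integral>\<^sup>+t\<in>I. ennreal \<bar>b t - c\<bar> \<partial>lborel) / ennreal (len I)"
proof -
  have [measurable]: "I \<in> sets borel" using I by (rule intervals_borel)
  have len: "len I > 0" using I by (rule intervals_len_pos)
  have eI: "emeasure lborel I = ennreal (len I)" using I by (rule emeasure_interval_eq_len)
  have int_c: "set_integrable lborel I (\<lambda>_. c)" for c :: real
    unfolding set_integrable_def using eI by (intro integrable_scaleR_left integrable_real_indicator) auto
  have int_bc: "set_integrable lborel I (\<lambda>t. b t - c)"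
    using b int_c by (rule set_integral_diff)
  have meas: "(\<lambda>t. indicat_real I t *\<^sub>R (b t - c)) \<in> borel_measurable lborel"
    using int_bc unfolding set_integrable_def by (rule borel_measurable_integrable)
  define N where "N = (\<integral>\<^sup>+t\<in>I. ennreal \<bar>b t - c\<bar> \<partial>lborel)"
  have N: "N = (\<integral>\<^sup>+t. ennreal \<bar>indicat_real I t *\<^sub>R (b t - c)\<bar> \<partial>lborel)"
    unfolding N_def by (intro nn_integral_cong) (auto simp: indicator_def)
  define m where "m = mean b I"
  have m: "m - c = (LINT t:I|lborel. b t - c) / len I"
  proof -
    have "(LINT t:I|lborel. b t - c) = (LINT t:I|lborel. b t) - (LINT t:I|lborel. c)"
      using b int_c by (rule set_integral_diff(2))
    also have "(LINT t:I|lborel. c) = c * len I"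
      unfolding set_lebesgue_integral_def by simp
    finally show ?thesis using len by (simp add: m_def mean_def field_simps)
  qed
  have "ennreal (\<bar>m - c\<bar> * len I) = ennreal \<bar>LINT t:I|lborel. b t - c\<bar>"
    unfolding m using len by (simp add: abs_mult)
  also have "\<dots> \<le> N"
    unfolding N set_lebesgue_integral_def
    using integral_norm_bound_ennreal[OF int_bc[unfolded set_integrable_def]] by simp
  finally have mc: "ennreal \<bar>m - c\<bar> * ennreal (len I) \<le> N"
    by (simp add: ennreal_mult)
  have "(\<integral>\<^sup>+t\<in>I. ennreal \<bar>b t - m\<bar> \<partial>lborel)
      \<le> (\<integral>\<^sup>+t. ennreal \<bar>indicat_real I t *\<^sub>R (b t - c)\<bar> + ennreal \<bar>m - c\<bar> * indicator I t \<partial>lborel)"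
  proof (rule nn_integral_mono)
    fix t
    have "\<bar>b t - m\<bar> \<le> \<bar>b t - c\<bar> + \<bar>m - c\<bar>" by linarith
    then have "ennreal \<bar>b t - m\<bar> \<le> ennreal \<bar>b t - c\<bar> + ennreal \<bar>m - c\<bar>"
      by (simp flip: ennreal_plus)
    then show "ennreal \<bar>b t - m\<bar> * indicator I t
        \<le> ennreal \<bar>indicat_real I t *\<^sub>R (b t - c)\<bar> + ennreal \<bar>m - c\<bar> * indicator I t"
      by (auto simp: indicator_def)
  qed
  also have "\<dots> = N + ennreal \<bar>m - c\<bar> * ennreal (len I)"
    unfolding N using meas by (subst nn_integral_add) (simp_all add: nn_integral_cmult_indicator eI)
  also have "\<dots> \<le> N + N" using mc by (rule add_left_mono)
  finally have "(\<integral>\<^sup>+t\<in>I. ennreal \<bar>b t - m\<bar> \<partial>lborel) \<le> 2 * N" by (simp add: mult_2)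
  then show ?thesis
    using b by (simp add: mean_osc_def m_def N_def divide_right_mono_ennreal)
qed

context finite_dyadic_carleson
begin

lemma balayage_eq:
  "balayage \<nu> t = (\<integral>\<^sup>+z. ennreal (poisson_kernel (fst z) (snd z) t) \<partial>\<nu>)"
  by (simp add: balayage_def case_prod_unfold)

sublocale P: pair_sigma_finite \<nu> lborel ..

lemma borel_measurable_balayage [measurable]: "balayage \<nu> \<in> borel_measurable lborel"
  unfolding balayage_eq[abs_def] by measurable

lemma nn_integral_balayage: "(\<integral>\<^sup>+t. balayage \<nu> t \<partial>lborel) = emeasure \<nu> (space \<nu>)"
proof -
  have "(\<integral>\<^sup>+t. balayage \<nu> t \<partial>lborel)
      = (\<integral>\<^sup>+z. (\<integral>\<^sup>+t. ennreal (poisson_kernel (fst z) (snd z) t) \<partial>lborel) \<partial>\<nu>)"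
    unfolding balayage_eq by (rule P.Fubini') measurable
  also have "\<dots> = (\<integral>\<^sup>+z. 1 \<partial>\<nu>)"
    by (intro nn_integral_cong nn_integral_poisson_kernel snd_pos)
  finally show ?thesis by simp
qed

lemma nn_integral_balayage_power2_finite: "(\<integral>\<^sup>+t. (balayage \<nu> t)\<^sup>2 \<partial>lborel) < \<infinity>"
proof -
  define k where "k z t = ennreal (poisson_kernel (fst z) (snd z) t)" for z :: "real \<times> real" and t
  \<comment> \<open>The lower point is the variable integrated first, and the decay kernel is placed
    under the higher point at the scale of its height. The factor 4 is the 2 of
    \<open>poisson_kernel_mult_le\<close> times the two kernel integrals.\<close>
  define G where "G z w = (if snd w \<le> snd z then 4 * ennreal (carleson_decay (fst z) (snd z) w) else 0)"
    for z w :: "real \<times> real"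
  have k_meas: "k z \<in> borel_measurable lborel" for z
    unfolding k_def by measurable
  have int_k: "(\<integral>\<^sup>+t. k z t \<partial>lborel) = 1" if "z \<in> space \<nu>" for z
    unfolding k_def using nn_integral_poisson_kernel snd_pos[OF that] by simp
  have kG: "(\<integral>\<^sup>+t. k z t * k w t \<partial>lborel) \<le> G z w"
    if "z \<in> space \<nu>" "w \<in> space \<nu>" "snd w \<le> snd z" for z w
  proof -
    define \<rho> where "\<rho> = carleson_decay (fst z) (snd z) w"
    have pos: "0 < snd z" "0 < snd w" using that snd_pos by auto
    then have "0 \<le> \<rho>" by (simp add: \<rho>_def carleson_decay_nonneg)
    have "(\<integral>\<^sup>+t. k z t * k w t \<partial>lborel) \<le> (\<integral>\<^sup>+t. ennreal (2 * \<rho>) * (k z t + k w t) \<partial>lborel)"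
    proof (rule nn_integral_mono)
      fix t
      show "k z t * k w t \<le> ennreal (2 * \<rho>) * (k z t + k w t)"
        using poisson_kernel_mult_le[OF pos(2) that(3), of "fst z" t "fst w"] pos \<open>0 \<le> \<rho>\<close>
        unfolding k_def \<rho>_def
        by (simp add: poisson_kernel_nonneg ennreal_leI flip: ennreal_mult ennreal_plus)
    qed
    also have "\<dots> = ennreal (2 * \<rho>) * 2"
      using k_meas int_k that by (simp add: nn_integral_cmult nn_integral_add)
    also have "\<dots> = ennreal (4 * \<rho>)"
      using \<open>0 \<le> \<rho>\<close> ennreal_mult[of "2 * \<rho>" 2] by simp
    also have "\<dots> = G z w"
      using that(3) \<open>0 \<le> \<rho>\<close> by (simp add: G_def \<rho>_def ennreal_mult)
    finally show ?thesis .
  qed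
  have "(\<integral>\<^sup>+t. (\<integral>\<^sup>+z. k z t \<partial>\<nu>)\<^sup>2 \<partial>lborel) \<le> 2 * ennreal (256 * C) * emeasure \<nu> (space \<nu>)"
  proof (rule nn_integral_kernel_power2_le[where G = G])
    show "case_prod k \<in> borel_measurable (\<nu> \<Otimes>\<^sub>M lborel)"
      unfolding k_def by measurable
    show "case_prod G \<in> borel_measurable (\<nu> \<Otimes>\<^sub>M \<nu>)"
      unfolding G_def by measurable
    fix z assume z: "z \<in> space \<nu>"
    show "(\<integral>\<^sup>+t. k z t * k w t \<partial>lborel) \<le> G z w + G w z" if w: "w \<in> space \<nu>" for w
    proof (cases "snd w \<le> snd z")
      case True
      then show ?thesis using kG[OF z w] by (auto intro: order_trans)
    next
      case False
      then show ?thesis using kG[OF w z] by (auto simp: mult.commute intro: order_trans)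
    qed
    have "(\<integral>\<^sup>+w. G z w \<partial>\<nu>) \<le> (\<integral>\<^sup>+w. 4 * ennreal (carleson_decay (fst z) (snd z) w) \<partial>\<nu>)"
      by (intro nn_integral_mono) (simp add: G_def)
    also have "\<dots> = 4 * (\<integral>\<^sup>+w. ennreal (carleson_decay (fst z) (snd z) w) \<partial>\<nu>)"
      by (rule nn_integral_cmult) measurable
    also have "\<dots> \<le> 4 * ennreal (64 * C)"
      by (intro mult_left_mono nn_integral_carleson_decay_le snd_pos z) simp
    also have "\<dots> = ennreal (256 * C)"
      using C_pos ennreal_mult[of 4 "64 * C"] by simp
    finally show "(\<integral>\<^sup>+w. G z w \<partial>\<nu>) \<le> ennreal (256 * C)" .
  qed (use sigma_finite_measure_axioms lborel.sigma_finite_measure_axioms in auto)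
  also have "\<dots> < \<infinity>"
    using finite by (simp add: ennreal_mult_less_top)
  finally show ?thesis by (simp add: balayage_eq k_def)
qed

lemma AE_balayage_finite: "AE t in lborel. balayage \<nu> t < \<infinity>"
proof -
  have "(\<integral>\<^sup>+t. balayage \<nu> t \<partial>lborel) \<noteq> \<infinity>"
    using finite by (simp add: nn_integral_balayage)
  then have "AE t in lborel. balayage \<nu> t \<noteq> \<infinity>"
    by (intro nn_integral_PInf_AE borel_measurable_balayage)
  then show ?thesis by eventually_elim (simp add: top.not_eq_extremum)
qed

lemma integrable_balayage: "integrable lborel (\<lambda>t. enn2real (balayage \<nu> t))"
proof (rule integrableI_nonneg)
  have "(\<integral>\<^sup>+t. ennreal (enn2real (balayage \<nu> t)) \<partial>lborel) = (\<integral>\<^sup>+t. balayage \<nu> t \<partial>lborel)"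
    using AE_balayage_finite by (intro nn_integral_cong_AE, eventually_elim) simp
  then show "(\<integral>\<^sup>+t. ennreal (enn2real (balayage \<nu> t)) \<partial>lborel) < \<infinity>"
    using finite by (simp add: nn_integral_balayage)
qed simp_all

lemma integrable_balayage_power2: "integrable lborel (\<lambda>t. (enn2real (balayage \<nu> t))\<^sup>2)"
proof (rule integrableI_nonneg)
  have "(\<integral>\<^sup>+t. ennreal ((enn2real (balayage \<nu> t))\<^sup>2) \<partial>lborel) = (\<integral>\<^sup>+t. (balayage \<nu> t)\<^sup>2 \<partial>lborel)"
    using AE_balayage_finite
    by (intro nn_integral_cong_AE, eventually_elim) (simp flip: ennreal_power)
  then show "(\<integral>\<^sup>+t. ennreal ((enn2real (balayage \<nu> t))\<^sup>2) \<partial>lborel) < \<infinity>"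
    using nn_integral_balayage_power2_finite by simp
qed simp_all

text \<open>The constant \<open>c\<close> is the value at the centre of \<open>J\<close> of the balayage of the part of \<open>\<nu>\<close> far
  from \<open>J\<close>.\<close>

lemma balayage_deviation_le:
  assumes r: "0 < r" and J: "J \<in> intervals" "J \<subseteq> {a - r..a + r}" "len J = 2 * r"
  shows "\<exists>c. (\<integral>\<^sup>+t\<in>J. ennreal \<bar>enn2real (balayage \<nu> t) - c\<bar> \<partial>lborel) \<le> ennreal (1408 * C * r)"
proof -
  have [measurable]: "J \<in> sets borel" using J by (intro intervals_borel)
  define p where "p t z = poisson_kernel (fst z) (snd z) t" for t and z :: "real \<times> real"
  \<comment> \<open>Points close to (a, 0) can have arbitrarily large kernels at \<open>a\<close>,
    so nothing is subtracted for near points; their whole kernel mass, at most 1, is accepted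
    instead.\<close>
  define g where "g z = (if \<bar>fst z - a\<bar> \<le> 2 * r \<and> snd z \<le> 4 * r then 0 else p a z)" for z
  have p_meas[measurable]: "p t \<in> borel_measurable \<nu>" for t unfolding p_def by measurable
  have g_meas[measurable]: "g \<in> borel_measurable \<nu>" unfolding g_def by measurable
  have p_nonneg: "0 \<le> p t z" if "z \<in> space \<nu>" for t z
    unfolding p_def using that by (intro poisson_kernel_nonneg snd_pos)
  have g_le: "\<bar>g z\<bar> \<le> 1 / r" if "z \<in> space \<nu>" for z
    using poisson_kernel_centre_le[OF snd_pos[OF that] r, of "fst z" a] p_nonneg[OF that, of a] r
    by (auto simp: g_def p_def)
  have int_g: "integrable \<nu> g"
    using g_le by (intro integrable_const_bound[where B = "1 / r"]) (auto simp: g_meas)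
  define c where "c = (\<integral>z. g z \<partial>\<nu>)"
  \<comment> \<open>For a near point the denominator of the decay kernel is at most (1 + 4 + 16)
    r^2, which 22 covers; for a far point 3 * 2 r = 6 r is enough. With the integral 64 C this leads
    to 1408 = 22 * 64.\<close>
  have kernel: "(\<integral>\<^sup>+t\<in>J. ennreal \<bar>p t z - g z\<bar> \<partial>lborel) \<le> ennreal (22 * r) * ennreal (carleson_decay a r z)"
    if z: "z \<in> space \<nu>" for z
  proof (cases "\<bar>fst z - a\<bar> \<le> 2 * r \<and> snd z \<le> 4 * r")
    case True
    have "(\<integral>\<^sup>+t\<in>J. ennreal \<bar>p t z - g z\<bar> \<partial>lborel) \<le> (\<integral>\<^sup>+t. ennreal (p t z) \<partial>lborel)"
      using True p_nonneg[OF z] by (intro nn_integral_mono) (auto simp: g_def indicator_def)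
    also have "\<dots> = ennreal 1"
      unfolding p_def using nn_integral_poisson_kernel[OF snd_pos[OF z]] by simp
    also have "\<dots> \<le> ennreal (22 * r * carleson_decay a r z)"
    proof (rule ennreal_leI)
      have x: "(fst z - a)\<^sup>2 \<le> (2 * r)\<^sup>2"
        using True r by (simp only: abs_le_square_iff[symmetric]) simp
      have y: "(snd z)\<^sup>2 \<le> (4 * r)\<^sup>2" using True snd_pos[OF z] by (intro power_mono) auto
      have gen: "q + u + v \<le> 22 * q" if "u \<le> 4 * q" "v \<le> 16 * q" "0 \<le> q" for q u v :: real
        using that by linarith
      have "r\<^sup>2 + (fst z - a)\<^sup>2 + (snd z)\<^sup>2 \<le> 22 * r\<^sup>2"
        by (rule gen) (use x y in \<open>simp_all add: power_mult_distrib\<close>)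
      then have "r\<^sup>2 + (fst z - a)\<^sup>2 + (snd z)\<^sup>2 \<le> 22 * r * r"
        by (simp add: power2_eq_square)
      then show "1 \<le> 22 * r * carleson_decay a r z"
        using r by (simp add: carleson_decay_def pos_le_divide_eq add_pos_nonneg)
    qed
    also have "\<dots> = ennreal (22 * r) * ennreal (carleson_decay a r z)"
      using r by (intro ennreal_mult carleson_decay_nonneg) auto
    finally show ?thesis .
  next
    case False
    then have gz: "g z = p a z" unfolding g_def by (rule if_not_P)
    have "(\<integral>\<^sup>+t\<in>J. ennreal \<bar>p t z - g z\<bar> \<partial>lborel)
        \<le> (\<integral>\<^sup>+t. ennreal (3 * carleson_decay a r z) * indicator J t \<partial>lborel)"
    proof (rule nn_integral_mono)
      fix t
      show "ennreal \<bar>p t z - g z\<bar> * indicator J t \<le> ennreal (3 * carleson_decay a r z) * indicator J t"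
      proof (cases "t \<in> J")
        case True
        then have "t \<in> {a - r..a + r}" using J by blast
        then have "\<bar>t - a\<bar> \<le> r" by (auto simp: abs_le_iff)
        then have "\<bar>p t z - g z\<bar> \<le> 3 * carleson_decay a r z"
          using poisson_kernel_diff_le[OF snd_pos[OF z] r _ False, of t] by (simp add: gz p_def)
        then show ?thesis by (intro mult_right_mono ennreal_leI) auto
      qed simp
    qed
    also have "\<dots> = ennreal (3 * carleson_decay a r z) * ennreal (2 * r)"
      using J by (simp add: nn_integral_cmult_indicator emeasure_interval_eq_len)
    also have "\<dots> = ennreal (3 * carleson_decay a r z * (2 * r))"
      using r by (intro ennreal_mult[symmetric]) (auto simp: carleson_decay_nonneg)
    also have "\<dots> \<le> ennreal (22 * r * carleson_decay a r z)"
      using mult_nonneg_nonneg[OF less_imp_le[OF r] carleson_decay_nonneg[OF less_imp_le[OF r], of a z]]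
      by (intro ennreal_leI) (simp add: mult.commute)
    also have "\<dots> = ennreal (22 * r) * ennreal (carleson_decay a r z)"
      using r by (intro ennreal_mult carleson_decay_nonneg) auto
    finally show ?thesis .
  qed
  \<comment> \<open>Writing the difference as one integral requires \<open>p t\<close> to be
    integrable, that is, the balayage to be finite at \<open>t\<close>.\<close>
  have dev: "AE t in lborel. ennreal \<bar>enn2real (balayage \<nu> t) - c\<bar> * indicator J t
      \<le> (\<integral>\<^sup>+z. ennreal \<bar>p t z - g z\<bar> * indicator J t \<partial>\<nu>)"
    using AE_balayage_finite
  proof eventually_elim
    case (elim t)
    have eq: "balayage \<nu> t = (\<integral>\<^sup>+z. ennreal (p t z) \<partial>\<nu>)" by (simp add: balayage_eq p_def)
    have int_p: "integrable \<nu> (p t)"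
      using elim p_nonneg by (intro integrableI_nonneg AE_I2) (auto simp: eq)
    have "enn2real (balayage \<nu> t) = (\<integral>z. p t z \<partial>\<nu>)"
      using p_nonneg unfolding eq by (intro integral_eq_nn_integral[symmetric] AE_I2) auto
    then have "enn2real (balayage \<nu> t) - c = (\<integral>z. p t z - g z \<partial>\<nu>)"
      using int_p int_g by (simp add: c_def)
    then have "ennreal \<bar>enn2real (balayage \<nu> t) - c\<bar> \<le> (\<integral>\<^sup>+z. ennreal \<bar>p t z - g z\<bar> \<partial>\<nu>)"
      using integral_norm_bound_ennreal[OF Bochner_Integration.integrable_diff[OF int_p int_g]] by simp
    then show ?case by (auto simp: indicator_def)
  qed
  have "(\<integral>\<^sup>+t\<in>J. ennreal \<bar>enn2real (balayage \<nu> t) - c\<bar> \<partial>lborel)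
      \<le> (\<integral>\<^sup>+t. (\<integral>\<^sup>+z. ennreal \<bar>p t z - g z\<bar> * indicator J t \<partial>\<nu>) \<partial>lborel)"
    by (rule nn_integral_mono_AE[OF dev])
  also have "\<dots> = (\<integral>\<^sup>+z. (\<integral>\<^sup>+t\<in>J. ennreal \<bar>p t z - g z\<bar> \<partial>lborel) \<partial>\<nu>)"
    unfolding p_def by (rule P.Fubini') measurable
  also have "\<dots> \<le> (\<integral>\<^sup>+z. ennreal (22 * r) * ennreal (carleson_decay a r z) \<partial>\<nu>)"
    by (intro nn_integral_mono kernel)
  also have "\<dots> = ennreal (22 * r) * (\<integral>\<^sup>+z. ennreal (carleson_decay a r z) \<partial>\<nu>)"
    by (rule nn_integral_cmult) measurable
  also have "\<dots> \<le> ennreal (22 * r) * ennreal (64 * C)"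
    using r by (intro mult_left_mono nn_integral_carleson_decay_le) auto
  also have "\<dots> = ennreal (1408 * C * r)"
    using r C_pos ennreal_mult[of "22 * r" "64 * C"] by (simp add: mult.commute mult.left_commute)
  finally show ?thesis by blast
qed

lemma bmo_norm_ext_balayage_le: "bmo_norm_ext (balayage \<nu>) \<le> ennreal (1408 * C)"
proof -
  define b where "b t = enn2real (balayage \<nu> t)" for t
  have "mean_osc 1 b J \<le> ennreal (1408 * C)" if J: "J \<in> intervals" for J
  proof -
    obtain a r where r: "0 < r" "J \<subseteq> {a - r..a + r}" "len J = 2 * r"
      using J by (rule interval_centre)
    obtain c where c: "(\<integral>\<^sup>+t\<in>J. ennreal \<bar>b t - c\<bar> \<partial>lborel) \<le> ennreal (1408 * C * r)"
      unfolding b_def using balayage_deviation_le[OF r(1) J r(2,3)] by blast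
    have "set_integrable lborel J b"
      unfolding set_integrable_def b_def
      using integrable_balayage intervals_borel[OF J] by (intro integrable_mult_indicator) auto
    then have "mean_osc 1 b J \<le> 2 * (\<integral>\<^sup>+t\<in>J. ennreal \<bar>b t - c\<bar> \<partial>lborel) / ennreal (len J)"
      using J by (intro mean_osc_1_le)
    also have "\<dots> \<le> 2 * ennreal (1408 * C * r) / ennreal (len J)"
      using c by (intro divide_right_mono_ennreal mult_left_mono) auto
    \<comment> \<open>The 2 lost in passing from \<open>c\<close> to the mean cancels against |J| =
      2 r.\<close>
    also have "2 * ennreal (1408 * C * r) = ennreal (1408 * C * (2 * r))"
      using r C_pos ennreal_mult[of 2 "1408 * C * r"] by (simp add: mult.left_commute)
    also have "ennreal (1408 * C * (2 * r)) / ennreal (len J) = ennreal (1408 * C)"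
      using r C_pos by (simp add: divide_ennreal)
    finally show ?thesis .
  qed
  then have "(SUP J\<in>intervals. mean_osc 1 b J) \<le> ennreal (1408 * C)" by (rule SUP_least)
  moreover have "b \<in> borel_measurable lborel" unfolding b_def by measurable
  ultimately show ?thesis
    using AE_balayage_finite integrable_balayage_power2
    by (simp add: bmo_norm_ext_def bmo_norm_def b_def[abs_def])
qed

end

section \<open>Poisson lower bound: near mass against far tails\<close>

text \<open>Within distance \<open>y\<close> of its centre the kernel is at least half of its
  maximum 1/(pi y).\<close>

lemma poisson_kernel_mass_ge:
  assumes "0 < y" "{x..x + y} \<subseteq> E"
  shows "ennreal (1 / (2 * pi)) \<le> (\<integral>\<^sup>+t\<in>E. ennreal (poisson_kernel x y t) \<partial>lborel)"
proof -
  have le: "1 / (2 * pi * y) \<le> poisson_kernel x y t" if "t \<in> {x..x + y}" for t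
  proof -
    have "(t - x)\<^sup>2 \<le> y\<^sup>2" using that by (intro power_mono) auto
    then have "y / (2 * y\<^sup>2) \<le> y / (y\<^sup>2 + (t - x)\<^sup>2)"
      using assms by (intro divide_left_mono mult_pos_pos add_pos_nonneg) auto
    then have "y / (2 * y\<^sup>2) / pi \<le> y / (y\<^sup>2 + (t - x)\<^sup>2) / pi"
      by (rule divide_right_mono) simp
    then show ?thesis
      using assms by (simp add: poisson_kernel_def power2_eq_square[of y] mult_ac)
  qed
  have "ennreal (1 / (2 * pi)) = ennreal (1 / (2 * pi * y)) * ennreal y"
    using assms by (simp flip: ennreal_mult)
  also have "\<dots> = (\<integral>\<^sup>+t. ennreal (1 / (2 * pi * y)) * indicator {x..x + y} t \<partial>lborel)"
    using assms by (simp add: nn_integral_cmult_indicator)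
  also have "\<dots> \<le> (\<integral>\<^sup>+t\<in>E. ennreal (poisson_kernel x y t) \<partial>lborel)"
    using assms(2) le by (intro nn_integral_mono) (auto simp: indicator_def intro!: ennreal_leI)
  finally show ?thesis .
qed

lemma poisson_kernel_le_if_dist_ge:
  assumes "0 < y" "y \<le> h" "7 * h \<le> t - x"
  shows "poisson_kernel x y t \<le> 1 / (49 * pi * h)"
proof -
  have "(7 * h)\<^sup>2 \<le> (t - x)\<^sup>2" using assms by (intro power_mono) auto
  then have "(7 * h)\<^sup>2 \<le> y\<^sup>2 + (t - x)\<^sup>2" by (simp add: add_increasing)
  then have "y / (y\<^sup>2 + (t - x)\<^sup>2) \<le> h / (7 * h)\<^sup>2"
    using assms by (intro frac_le) auto
  then have "y / (y\<^sup>2 + (t - x)\<^sup>2) / pi \<le> h / (7 * h)\<^sup>2 / pi"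
    by (rule divide_right_mono) simp
  also have "h / (7 * h)\<^sup>2 / pi = 1 / (49 * pi * h)"
    using assms by (simp add: field_simps power2_eq_square)
  finally show ?thesis by (simp add: poisson_kernel_def mult.commute)
qed

text \<open>The balayage of a measure on \<open>Q\<^sub>I\<close> has mean at least a constant times \<open>\<nu>(Q\<^sub>I)/|I|\<close> near \<open>I\<close>, but
  is much smaller at distance \<open>7|I|\<close>, so it oscillates on an interval of length \<open>10|I|\<close>.\<close>

lemma (in finite_dyadic_carleson) measure_le_bmo_norm_ext:
  assumes I: "I = {\<alpha><..\<alpha> + h}" and h: "0 < h"
    and supp: "AE z in \<nu>. z \<in> carleson_square I"
    and bmo: "bmo_norm_ext (balayage \<nu>) \<le> ennreal \<beta>" and "0 \<le> \<beta>"
  shows "measure \<nu> (space \<nu>) \<le> 160 * \<beta> * h"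
proof -
  define b where "b t = enn2real (balayage \<nu> t)" for t
  define m where "m = measure \<nu> (space \<nu>)"
  have em: "emeasure \<nu> (space \<nu>) = ennreal m" by (simp add: m_def emeasure_eq_measure)
  have "0 \<le> m" by (simp add: m_def)
  \<comment> \<open>\<open>E1\<close> contains [x, x + y] for every point of the square, since x + y
    \<le> \<alpha> + 2 h, and \<open>E2\<close> is at distance at least 7 h from all abscissae.
    Their equal length makes the mean of \<open>b\<close> cancel in the comparison.\<close>
  define L E1 E2 where "L = {\<alpha>..\<alpha> + 10 * h}" and "E1 = {\<alpha>..\<alpha> + 2 * h}"
    and "E2 = {\<alpha> + 8 * h..\<alpha> + 10 * h}"
  have [measurable]: "L \<in> sets borel" "E1 \<in> sets borel" "E2 \<in> sets borel"
    by (simp_all add: L_def E1_def E2_def)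
  have len: "len L = 10 * h" "len E1 = 2 * h" "len E2 = 2 * h"
    using h by (simp_all add: L_def E1_def E2_def)
  have L: "L \<in> intervals"
    using h len by (simp add: intervals_def L_def is_interval_cc)
  have lenI: "len I = h" using h by (simp add: I)
  have supp': "AE z in \<nu>. \<alpha> < fst z \<and> fst z \<le> \<alpha> + h \<and> 0 < snd z \<and> snd z \<le> h"
    using supp by eventually_elim (auto simp: carleson_square_def lenI, auto simp: I)
  define c where "c = mean b L"
  have "(SUP J\<in>intervals. mean_osc 1 b J) \<le> ennreal \<beta>"
    using bmo AE_balayage_finite
    by (auto simp: bmo_norm_ext_def bmo_norm_def b_def[abs_def] top_unique split: if_splits)
  then have "mean_osc 1 b L \<le> ennreal \<beta>"
    using SUP_upper[OF L] by (rule order_trans[rotated])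
  then have osc: "(\<integral>\<^sup>+t\<in>L. ennreal \<bar>b t - c\<bar> \<partial>lborel) / ennreal (len L) \<le> ennreal \<beta>"
    by (auto simp: mean_osc_def c_def top_unique split: if_splits)
  have b_int: "integrable lborel b" unfolding b_def[abs_def] by (rule integrable_balayage)
  have b_nonneg: "0 \<le> b t" for t by (simp add: b_def)
  have set_b: "integrable lborel (\<lambda>t. indicat_real E t * b t)" if "E \<in> sets borel" for E
    using integrable_mult_indicator[OF _ b_int, of E] that by simp
  have ind: "integrable lborel (indicat_real E)" if "E \<in> {L, E1, E2}" for E
    using that h by (intro integrable_real_indicator) (auto simp: L_def E1_def E2_def)
  have set_bc: "integrable lborel (\<lambda>t. indicat_real E t * (b t - c))" if "E \<in> {L, E1, E2}" for E
  proof -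
    have "integrable lborel (\<lambda>t. indicat_real E t * b t - c * indicat_real E t)"
      using that by (intro Bochner_Integration.integrable_diff set_b integrable_mult_right ind) auto
    then show ?thesis by (simp add: algebra_simps)
  qed
  have eq_int: "ennreal (\<integral>t. indicat_real E t * b t \<partial>lborel)
      = (\<integral>\<^sup>+z. (\<integral>\<^sup>+t\<in>E. ennreal (poisson_kernel (fst z) (snd z) t) \<partial>lborel) \<partial>\<nu>)"
    if [measurable]: "E \<in> sets borel" for E
  proof -
    have "ennreal (\<integral>t. indicat_real E t * b t \<partial>lborel) = (\<integral>\<^sup>+t. ennreal (indicat_real E t * b t) \<partial>lborel)"
      using b_nonneg by (intro nn_integral_eq_integral[symmetric] set_b that) auto
    also have "\<dots> = (\<integral>\<^sup>+t. balayage \<nu> t * indicator E t \<partial>lborel)"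
      using AE_balayage_finite
      by (intro nn_integral_cong_AE, eventually_elim) (auto simp: b_def indicator_def)
    also have "\<dots> = (\<integral>\<^sup>+t. (\<integral>\<^sup>+z. ennreal (poisson_kernel (fst z) (snd z) t) * indicator E t \<partial>\<nu>) \<partial>lborel)"
      unfolding balayage_eq by (intro nn_integral_cong nn_integral_multc[symmetric]) measurable
    also have "\<dots> = (\<integral>\<^sup>+z. (\<integral>\<^sup>+t\<in>E. ennreal (poisson_kernel (fst z) (snd z) t) \<partial>lborel) \<partial>\<nu>)"
      by (rule P.Fubini') measurable
    finally show ?thesis .
  qed
  define A1 A2 where "A1 = (\<integral>t. indicat_real E1 t * b t \<partial>lborel)"
    and "A2 = (\<integral>t. indicat_real E2 t * b t \<partial>lborel)"
  have A2_nonneg: "0 \<le> A2" unfolding A2_def by (rule Bochner_Integration.integral_nonneg) (simp add: b_nonneg)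
  have A1_nonneg: "0 \<le> A1" unfolding A1_def by (rule Bochner_Integration.integral_nonneg) (simp add: b_nonneg)
  have A1: "m / pi / 2 \<le> A1"
  proof -
    have "ennreal (1 / (2 * pi) * m) = ennreal (1 / (2 * pi)) * ennreal m"
      using \<open>0 \<le> m\<close> by (intro ennreal_mult) auto
    also have "\<dots> = (\<integral>\<^sup>+z. ennreal (1 / (2 * pi)) \<partial>\<nu>)"
      by (simp add: em)
    also have "\<dots> \<le> (\<integral>\<^sup>+z. (\<integral>\<^sup>+t\<in>E1. ennreal (poisson_kernel (fst z) (snd z) t) \<partial>lborel) \<partial>\<nu>)"
    proof (rule nn_integral_mono_AE)
      show "AE z in \<nu>. ennreal (1 / (2 * pi))
          \<le> (\<integral>\<^sup>+t\<in>E1. ennreal (poisson_kernel (fst z) (snd z) t) \<partial>lborel)"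
        using supp' by eventually_elim (intro poisson_kernel_mass_ge, auto simp: E1_def)
    qed
    also have "\<dots> = ennreal A1" unfolding A1_def by (rule eq_int[symmetric]) simp
    finally show ?thesis using A1_nonneg by (simp add: ennreal_le_iff mult_ac)
  qed
  have A2: "A2 \<le> 2 / 49 * (m / pi)"
  proof -
    have "ennreal A2 = (\<integral>\<^sup>+z. (\<integral>\<^sup>+t\<in>E2. ennreal (poisson_kernel (fst z) (snd z) t) \<partial>lborel) \<partial>\<nu>)"
      unfolding A2_def by (rule eq_int) simp
    also have "\<dots> \<le> (\<integral>\<^sup>+z. ennreal (2 / 49 / pi) \<partial>\<nu>)"
    proof (rule nn_integral_mono_AE)
      show "AE z in \<nu>. (\<integral>\<^sup>+t\<in>E2. ennreal (poisson_kernel (fst z) (snd z) t) \<partial>lborel) \<le> ennreal (2 / 49 / pi)"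
        using supp'
      proof eventually_elim
        case (elim z)
        have "(\<integral>\<^sup>+t\<in>E2. ennreal (poisson_kernel (fst z) (snd z) t) \<partial>lborel)
            \<le> (\<integral>\<^sup>+t. ennreal (1 / (49 * pi * h)) * indicator E2 t \<partial>lborel)"
        proof (rule nn_integral_mono)
          fix t
          show "ennreal (poisson_kernel (fst z) (snd z) t) * indicator E2 t
              \<le> ennreal (1 / (49 * pi * h)) * indicator E2 t"
          proof (cases "t \<in> E2")
            case True
            then have "7 * h \<le> t - fst z" using elim by (auto simp: E2_def)
            then have "poisson_kernel (fst z) (snd z) t \<le> 1 / (49 * pi * h)"
              using elim by (intro poisson_kernel_le_if_dist_ge) auto
            then show ?thesis by (intro mult_right_mono ennreal_leI) auto
          qed simp
        qed
        also have "\<dots> = ennreal (1 / (49 * pi * h)) * ennreal (2 * h)"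
          using h by (simp add: nn_integral_cmult_indicator) (simp add: E2_def)
        also have "\<dots> = ennreal (1 / (49 * pi * h) * (2 * h))"
          using h by (intro ennreal_mult[symmetric]) auto
        also have "1 / (49 * pi * h) * (2 * h) = 2 / 49 / pi" using h by simp
        finally show ?case .
      qed
    qed
    also have "\<dots> = ennreal (2 / 49 / pi) * ennreal m" by (simp add: em)
    also have "\<dots> = ennreal (2 / 49 / pi * m)" using \<open>0 \<le> m\<close> by (intro ennreal_mult[symmetric]) auto
    finally have "A2 \<le> 2 / 49 / pi * m" using \<open>0 \<le> m\<close> by (subst (asm) ennreal_le_iff) auto
    then show ?thesis by simp
  qed
  \<comment> \<open>Subtracting \<open>c\<close> changes both integrals by 2 h c; the sets are
    disjoint subsets of \<open>L\<close>, so the difference is bounded by the absolute deviation on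
    \<open>L\<close>.\<close>
  have diff: "A1 - A2 \<le> (\<integral>t. indicat_real L t * \<bar>b t - c\<bar> \<partial>lborel)"
  proof -
    have shift: "(\<integral>t. indicat_real E t * (b t - c) \<partial>lborel) = (\<integral>t. indicat_real E t * b t \<partial>lborel) - 2 * h * c"
      if E: "E \<in> {E1, E2}" for E
    proof -
      have "(\<integral>t. indicat_real E t * (b t - c) \<partial>lborel)
          = (\<integral>t. indicat_real E t * b t - c * indicat_real E t \<partial>lborel)"
        by (simp add: algebra_simps)
      also have "\<dots> = (\<integral>t. indicat_real E t * b t \<partial>lborel) - (\<integral>t. c * indicat_real E t \<partial>lborel)"
        using E by (intro Bochner_Integration.integral_diff set_b integrable_mult_right ind) auto
      also have "(\<integral>t. c * indicat_real E t \<partial>lborel) = 2 * h * c"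
        using E len by auto
      finally show ?thesis .
    qed
    have "A1 - A2 = (\<integral>t. indicat_real E1 t * (b t - c) \<partial>lborel) - (\<integral>t. indicat_real E2 t * (b t - c) \<partial>lborel)"
      by (simp add: shift A1_def A2_def)
    also have "\<dots> = (\<integral>t. indicat_real E1 t * (b t - c) - indicat_real E2 t * (b t - c) \<partial>lborel)"
      by (intro Bochner_Integration.integral_diff[symmetric] set_bc) auto
    also have "\<dots> \<le> (\<integral>t. \<bar>indicat_real L t * (b t - c)\<bar> \<partial>lborel)"
    proof (rule integral_mono)
      fix t
      have "\<not> (t \<in> E1 \<and> t \<in> E2)" "t \<in> E1 \<or> t \<in> E2 \<Longrightarrow> t \<in> L"
        using h by (auto simp: E1_def E2_def L_def)
      then show "indicat_real E1 t * (b t - c) - indicat_real E2 t * (b t - c) \<le> \<bar>indicat_real L t * (b t - c)\<bar>"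
        by (auto simp: indicator_def)
    qed (intro Bochner_Integration.integrable_diff integrable_abs set_bc; simp)+
    finally show ?thesis by (simp add: abs_mult)
  qed
  have "(\<integral>t. indicat_real L t * \<bar>b t - c\<bar> \<partial>lborel) \<le> 10 * \<beta> * h"
  proof -
    have "ennreal (\<integral>t. indicat_real L t * \<bar>b t - c\<bar> \<partial>lborel) = (\<integral>\<^sup>+t. ennreal (indicat_real L t * \<bar>b t - c\<bar>) \<partial>lborel)"
      using integrable_abs[OF set_bc[of L]]
      by (intro nn_integral_eq_integral[symmetric]) (auto simp: abs_mult)
    also have "\<dots> = (\<integral>\<^sup>+t\<in>L. ennreal \<bar>b t - c\<bar> \<partial>lborel)"
      by (intro nn_integral_cong) (auto simp: indicator_def)
    also have "\<dots> = (\<integral>\<^sup>+t\<in>L. ennreal \<bar>b t - c\<bar> \<partial>lborel) / ennreal (len L) * ennreal (len L)"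
      using h by (simp add: ennreal_divide_times ennreal_divide_self len)
    also have "\<dots> \<le> ennreal \<beta> * ennreal (len L)"
      using osc by (rule mult_right_mono) simp
    also have "\<dots> = ennreal (10 * \<beta> * h)"
      using h \<open>0 \<le> \<beta>\<close> by (simp add: len mult_ac flip: ennreal_mult)
    finally show ?thesis using h \<open>0 \<le> \<beta>\<close> by (simp add: ennreal_le_iff)
  qed
  with A1 A2 diff have "m / pi / 2 - 2 / 49 * (m / pi) \<le> 10 * \<beta> * h" by linarith
  moreover have "m \<le> 4 * (m / pi)"
    using mult_left_mono[OF less_imp_le[OF pi_less_4] \<open>0 \<le> m\<close>] by (simp add: field_simps)
  \<comment> \<open>Here \<open>q\<close> stands for m / pi. Since 1/2 - 2/49 exceeds 1/4, the
    constant 4 * 4 * 10 = 160 suffices.\<close>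
  moreover have "m \<le> 160 * X" if "q / 2 - 2 / 49 * q \<le> 10 * X" "m \<le> 4 * q" "0 \<le> q" for q X :: real
    using that by linarith
  moreover have "0 \<le> m / pi" using \<open>0 \<le> m\<close> by simp
  ultimately show ?thesis
    unfolding m_def[symmetric] by (metis mult.assoc)
qed

section \<open>Restriction to Carleson squares and the final comparison\<close>

text \<open>Two constants are kept apart: \<open>C\<close> is an arbitrary dyadic competitor for
  \<open>Carl\<close>, whereas finiteness of the restricted mass comes from the constant hidden in
  \<open>carleson_measure\<close>.\<close>

lemma finite_dyadic_carleson_restriction:
  assumes \<mu>: "carleson_measure \<mu>" and I: "I \<in> intervals" and "0 < C"
    and C: "\<And>J. J \<in> dyadic_intervals \<Longrightarrow> emeasure \<mu> (carleson_square J) \<le> ennreal (C * len J)"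
  shows "finite_dyadic_carleson (measure_restriction \<mu> (carleson_square I)) C"
    and "emeasure (measure_restriction \<mu> (carleson_square I))
        (space (measure_restriction \<mu> (carleson_square I))) = emeasure \<mu> (carleson_square I)"
    and "AE z in measure_restriction \<mu> (carleson_square I). z \<in> carleson_square I"
proof -
  have sets: "sets \<mu> = sets (restrict_space borel upper_half_plane)"
    using \<mu> by (simp add: carleson_measure_def regular_borel_measure_def)
  have Q: "carleson_square J \<in> sets \<mu>" if "J \<in> intervals" for J
    using carleson_square_measurable[OF that] sets by simp
  have space: "space (measure_restriction \<mu> (carleson_square I)) = space \<mu>"
    by (simp add: measure_restriction_def)
  show total: "emeasure (measure_restriction \<mu> (carleson_square I))
        (space (measure_restriction \<mu> (carleson_square I))) = emeasure \<mu> (carleson_square I)"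
    using Q[OF I] sets.sets_into_space[OF Q[OF I]]
    by (simp add: space emeasure_measure_restriction Int_absorb2)
  show "AE z in measure_restriction \<mu> (carleson_square I). z \<in> carleson_square I"
    unfolding measure_restriction_def using Q[OF I]
    by (subst AE_density) (auto simp: indicator_def)
  show "finite_dyadic_carleson (measure_restriction \<mu> (carleson_square I)) C"
  proof
    show "sets (measure_restriction \<mu> (carleson_square I)) = sets (restrict_space borel upper_half_plane)"
      by (simp add: sets_measure_restriction sets)
    obtain C' where "emeasure \<mu> (carleson_square I) \<le> ennreal (C' * len I)"
      using \<mu> I by (auto simp: carleson_measure_def)
    then show "emeasure (measure_restriction \<mu> (carleson_square I))
        (space (measure_restriction \<mu> (carleson_square I))) < \<infinity>"
      unfolding total by (auto simp: top_unique less_top[symmetric])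
    fix J assume J: "J \<in> dyadic_intervals"
    then have "J \<in> intervals" using dyadic_intervals_subset by blast
    then have "emeasure (measure_restriction \<mu> (carleson_square I)) (carleson_square J)
        \<le> emeasure \<mu> (carleson_square J)"
      using Q I by (simp add: emeasure_measure_restriction emeasure_mono)
    also have "\<dots> \<le> ennreal (C * len J)" using J by (rule C)
    finally show "emeasure (measure_restriction \<mu> (carleson_square I)) (carleson_square J)
        \<le> ennreal (C * len J)" .
  qed fact
qed

lemma bmo_norm_le_Carl:
  assumes "carleson_measure \<mu>" "I \<in> intervals"
  shows "bmo_norm_ext (balayage (measure_restriction \<mu> (carleson_square I))) \<le> ennreal 1408 * Carl \<mu>"
  using finite_dyadic_carleson.bmo_norm_ext_balayage_le[OF finite_dyadic_carleson_restriction(1)[OF assms]]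
  by (intro le_mult_Carl) auto

lemma Carl_le_bmo_norm:
  assumes \<mu>: "carleson_measure \<mu>"
    and B: "\<And>I. I \<in> intervals \<Longrightarrow>
        bmo_norm_ext (balayage (measure_restriction \<mu> (carleson_square I))) \<le> B"
  shows "Carl \<mu> \<le> ennreal 160 * B"
proof (rule Carl_le)
  fix I assume I: "I \<in> dyadic_intervals"
  then have I': "I \<in> intervals" using dyadic_intervals_subset by blast
  have len: "len I > 0" using I' by (rule intervals_len_pos)
  show "emeasure \<mu> (carleson_square I) \<le> ennreal 160 * B * ennreal (len I)"
  proof (cases B)
    case (real \<beta>)
    \<comment> \<open>This constant only gives access to the locale; the resulting estimate is in
      terms of \<beta>.\<close>
    obtain C where C: "C > 0" "\<And>J. J \<in> intervals \<Longrightarrow> emeasure \<mu> (carleson_square J) \<le> ennreal (C * len J)"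
      using \<mu> by (auto simp: carleson_measure_def)
    then have C': "\<And>J. J \<in> dyadic_intervals \<Longrightarrow> emeasure \<mu> (carleson_square J) \<le> ennreal (C * len J)"
      using dyadic_intervals_subset by blast
    note R = finite_dyadic_carleson_restriction[OF \<mu> I' C(1) C']
    define \<nu> where "\<nu> = measure_restriction \<mu> (carleson_square I)"
    interpret finite_dyadic_carleson \<nu> C unfolding \<nu>_def by (rule R)
    obtain k n :: int where I_eq: "I = {of_int k * 2 powi n <.. (of_int k + 1) * 2 powi n}"
      "len I = 2 powi n" using I by (rule dyadic_intervalE)
    have "measure \<nu> (space \<nu>) \<le> 160 * \<beta> * len I"
    proof (rule measure_le_bmo_norm_ext)
      show "I = {of_int k * 2 powi n<..of_int k * 2 powi n + len I}"
        unfolding I_eq(2) by (subst I_eq(1)) (simp add: algebra_simps)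
      show "AE z in \<nu>. z \<in> carleson_square I" unfolding \<nu>_def by (rule R)
      show "bmo_norm_ext (balayage \<nu>) \<le> ennreal \<beta>"
        using B[OF I'] real by (simp add: \<nu>_def)
    qed (use len real in auto)
    then have "emeasure \<nu> (space \<nu>) \<le> ennreal (160 * \<beta> * len I)"
      by (simp add: emeasure_eq_measure ennreal_leI)
    then show ?thesis
      using R(2) real len by (simp add: \<nu>_def ennreal_mult)
  qed (use len in \<open>simp add: ennreal_mult_top ennreal_top_mult\<close>)
qed simp

theorem theorem4p3:
  shows "\<exists>C::real. C > 0 \<and>
    (\<forall>\<mu> :: (real \<times> real) measure. carleson_measure \<mu> \<longrightarrow>
      comparable C
        (Carl \<mu>)
        (SUP E\<in>{E. E \<in> sets borel \<and> E \<subseteq> upper_half_plane}.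
           dyadic_bmo_norm_ext (dyadic_balayage (measure_restriction \<mu> E))) \<and>
      comparable C
        (SUP E\<in>{E. E \<in> sets borel \<and> E \<subseteq> upper_half_plane}.
           dyadic_bmo_norm_ext (dyadic_balayage (measure_restriction \<mu> E)))
        (SUP I\<in>intervals.
           bmo_norm_ext (balayage (measure_restriction \<mu> (carleson_square I)))))"
proof (intro exI[of _ 5632] conjI allI impI)
  fix \<mu> :: "(real \<times> real) measure"
  assume \<mu>: "carleson_measure \<mu>"
  then have reg: "regular_borel_measure \<mu>" by (simp add: carleson_measure_def)
  define D where "D = (SUP E\<in>{E. E \<in> sets borel \<and> E \<subseteq> upper_half_plane}.
      dyadic_bmo_norm_ext (dyadic_balayage (measure_restriction \<mu> E)))"
  define B where "B = (SUP I\<in>intervals. bmo_norm_ext (balayage (measure_restriction \<mu> (carleson_square I))))"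
  have DA: "D \<le> ennreal 2 * Carl \<mu>"
    unfolding D_def using dyadic_bmo_norm_le_Carl[OF reg] by (intro SUP_least) auto
  have AD: "Carl \<mu> \<le> ennreal 4 * D"
    unfolding D_def by (intro Carl_le_dyadic_bmo_norm[OF reg] SUP_upper) auto
  have BA: "B \<le> ennreal 1408 * Carl \<mu>"
    unfolding B_def by (intro SUP_least bmo_norm_le_Carl[OF \<mu>])
  have AB: "Carl \<mu> \<le> ennreal 160 * B"
    unfolding B_def by (intro Carl_le_bmo_norm[OF \<mu>] SUP_upper)
  \<comment> \<open>All comparisons pass through \<open>Carl\<close>. The largest constant arises
    from B against D, where 1408 * 4 = 5632; the opposite direction needs 2 * 160.\<close>
  have trans: "x \<le> ennreal 5632 * z"
    if "x \<le> ennreal p * y" "y \<le> ennreal q * z" "0 \<le> p" "0 \<le> q" "p * q \<le> 5632"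
    for x y z :: ennreal and p q :: real
  proof -
    have "x \<le> ennreal p * (ennreal q * z)"
      using that(1) mult_left_mono[OF that(2)] by (rule order_trans) simp
    also have "\<dots> = ennreal (p * q) * z" using that by (simp add: ennreal_mult mult.assoc)
    also have "\<dots> \<le> ennreal 5632 * z" using that by (intro mult_right_mono ennreal_leI) auto
    finally show ?thesis .
  qed
  show "comparable 5632 (Carl \<mu>) D"
    unfolding comparable_def
    using trans[OF AD, of 1 D] trans[OF DA, of 1 "Carl \<mu>"] by simp
  show "comparable 5632 D B"
    unfolding comparable_def using trans[OF DA AB] trans[OF BA AD] by simp
qed simp

end
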